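(* Let $\Delta t>0$ and $n\ge0$. Given $u_h^{n-1},u_h^n\in V_h$ and $U^n\in C^0(\Omega)$, put $u_h^{n,*}=\frac32u_h^n-\frac12u_h^{n-1}$ and consider the scheme: find $u_h^{n+1}\in V_h$ and $U^{n+1}\in C^0(\Omega)$ such that, with $U_h^n=\Pi U^n$, $u_h^{n+1/2}=\frac12(u_h^n+u_h^{n+1})$ and $\bar U^{n+1/2}=\frac12(U^{n+1}+U_h^n)$, for all $\phi\in V_h$ $$\left(\frac{u_h^{n+1/2}-u_h^n}{\frac12\Delta t},\phi\right)=-A(\epsilon^2;u_h^{n+1/2},\phi)-\left(H(u_h^{n,*})\bar U^{n+1/2},\phi\right),$$ $$\frac{\bar U^{n+1/2}-U_h^n}{\frac12\Delta t}=\frac12H(u_h^{n,*})\frac{u_h^{n+1/2}-u_h^n}{\frac12\Delta t}\quad\text{(pointwise)}.$$ Then for any $\Delta t>0$ the scheme admits a unique solution $u_h^{n+1}\in V_h$, $U^{n+1}\in C^0(\Omega)$, and, with $U_h^{n+1}=\Pi U^{n+1}$, it satisfies the energy dissipation law $$E(u_h^{n+1},U_h^{n+1})\le E(u_h^{n+1},U^{n+1})=E(u_h^n,U_h^n)-\frac1{\Delta t}\|u_h^{n+1}-u_h^n\|^2.$$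
   Context: $\Omega\subset\mathbb{R}^d$ ($d=2,3$) is a bounded domain and $\epsilon>0$ is a constant. $\mathcal T$ is a quasi-uniform triangulation $\Omega=\cup_{i=1}^N T_i$, and $V_h=\{v\in C^0(\Omega)\cap H^1(\Omega): v|_{T_i}\in P_k\ \forall T_i\in\mathcal T\}$, where $P_k$ is the space of polynomials of degree at most $k$ ($k\ge1$ fixed). $C^0(\Omega)$ denotes functions continuous on $\overline\Omega$. $(\cdot,\cdot)$ and $\|\cdot\|$ are the $L^2(\Omega)$ inner product and norm. $\Pi$ is the $L^2(\Omega)$-orthogonal projection onto $V_h$. For a coefficient $a(x)$, $A(a;q,v)=\int_\Omega a(x)\nabla q\cdot\nabla v\,dx$. The potential $F$ is a $C^1$ function on an interval $I\subseteq\mathbb{R}$ (e.g. $F(u)=\frac14(u^2-1)^2$ with $I=\mathbb{R}$, or the logarithmic Flory–Huggins potential with $I=(0,1)$). The constant $B\ge0$ is such that $F+B>0$, and $H(w)=F'(w)/\sqrt{F(w)+B}$. It is a standing assumption that all functions at which $F,F',H$ are evaluated take values (on $\overline\Omega$) where these are defined and $F+B>0$. The energy is $E(v,V)=\frac12A(\epsilon^2;v,v)+\int_\Omega V^2\,dx-B|\Omega|$. *)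

theory Defs
  imports "HOL-Analysis.Analysis"
begin

definition L2_space :: "(real^'d) set \<Rightarrow> (real^'d \<Rightarrow> 'b::euclidean_space) set" where
  "L2_space \<Omega> = {f. set_borel_measurable lebesgue \<Omega> f \<and>
                     set_integrable lebesgue \<Omega> (\<lambda>x. (norm (f x))\<^sup>2)}"

definition L2_inner :: "(real^'d) set \<Rightarrow> (real^'d \<Rightarrow> real) \<Rightarrow> (real^'d \<Rightarrow> real) \<Rightarrow> real" where
  "L2_inner \<Omega> f g = (LINT x:\<Omega>|lebesgue. f x * g x)"

definition L2_norm :: "(real^'d) set \<Rightarrow> (real^'d \<Rightarrow> real) \<Rightarrow> real" where
  "L2_norm \<Omega> f = sqrt (L2_inner \<Omega> f f)"

definition partial_deriv :: "'d \<Rightarrow> (real^'d \<Rightarrow> real) \<Rightarrow> real^'d \<Rightarrow> real" where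
  "partial_deriv i f x = frechet_derivative f (at x) (axis i 1)"

primrec C_k :: "nat \<Rightarrow> (real^'d \<Rightarrow> real) \<Rightarrow> bool" where
  "C_k 0 f \<longleftrightarrow> continuous_on UNIV f"
| "C_k (Suc m) f \<longleftrightarrow> (\<forall>x. f differentiable (at x)) \<and> (\<forall>i. C_k m (partial_deriv i f))"

definition test_functions :: "(real^'d) set \<Rightarrow> (real^'d \<Rightarrow> real) set" where
  "test_functions \<Omega> = {\<phi>. (\<forall>m. C_k m \<phi>) \<and> compact (closure {x. \<phi> x \<noteq> 0}) \<and>
                            closure {x. \<phi> x \<noteq> 0} \<subseteq> \<Omega>}"

definition is_weak_gradient ::
  "(real^'d) set \<Rightarrow> (real^'d \<Rightarrow> real) \<Rightarrow> (real^'d \<Rightarrow> real^'d) \<Rightarrow> bool" where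
  "is_weak_gradient \<Omega> v g \<longleftrightarrow>
     (\<forall>\<phi>\<in>test_functions \<Omega>. \<forall>i.
        (LINT x:\<Omega>|lebesgue. v x * partial_deriv i \<phi> x) = - (LINT x:\<Omega>|lebesgue. g x $ i * \<phi> x))"

definition H1_space :: "(real^'d) set \<Rightarrow> (real^'d \<Rightarrow> real) set" where
  "H1_space \<Omega> = {v \<in> L2_space \<Omega>. \<exists>g\<in>L2_space \<Omega>. is_weak_gradient \<Omega> v g}"

text \<open>For \<open>v\<close> in \<open>H\<^sup>1\<close> this selects one representative of the weak gradient, which is determined
  only up to null sets of \<open>\<Omega>\<close>.\<close>

definition weak_grad :: "(real^'d) set \<Rightarrow> (real^'d \<Rightarrow> real) \<Rightarrow> real^'d \<Rightarrow> real^'d" where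
  "weak_grad \<Omega> v = (SOME g. g \<in> L2_space \<Omega> \<and> is_weak_gradient \<Omega> v g)"

definition A_form ::
  "(real^'d) set \<Rightarrow> (real^'d \<Rightarrow> real) \<Rightarrow> (real^'d \<Rightarrow> real) \<Rightarrow> (real^'d \<Rightarrow> real) \<Rightarrow> real" where
  "A_form \<Omega> a q v = (LINT x:\<Omega>|lebesgue. a x * (weak_grad \<Omega> q x \<bullet> weak_grad \<Omega> v x))"

text \<open>The cells are closed simplices of full dimension, and \<open>\<Omega>\<close> is their union up to boundary
  points. \<open>T \<inter> T'\<close> being a common face (possibly empty) is part of \<open>triangulation\<close>.\<close>

definition triangulates :: "(real^'d) set set \<Rightarrow> (real^'d) set \<Rightarrow> bool" where
  "triangulates \<T> \<Omega> \<longleftrightarrow>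
     triangulation \<T> \<and> (\<forall>T\<in>\<T>. int CARD('d) simplex T) \<and> \<Union>\<T> = closure \<Omega>"

definition inradius :: "(real^'d) set \<Rightarrow> real" where
  "inradius T = Sup {r. 0 \<le> r \<and> (\<exists>x. cball x r \<subseteq> T)}"

text \<open>Shape regularity and comparability of the cell sizes in one condition, with constant \<open>\<sigma>\<close>.\<close>

definition quasi_uniform :: "real \<Rightarrow> (real^'d) set set \<Rightarrow> bool" where
  "quasi_uniform \<sigma> \<T> \<longleftrightarrow> (\<forall>T\<in>\<T>. \<forall>T'\<in>\<T>. diameter T \<le> \<sigma> * inradius T')"

definition poly_space :: "nat \<Rightarrow> (real^'d \<Rightarrow> real) set" where
  "poly_space k = {p. \<exists>c. \<forall>x. p x =
     (\<Sum>\<alpha>\<in>{\<alpha>::'d \<Rightarrow> nat. (\<Sum>i\<in>UNIV. \<alpha> i) \<le> k}. c \<alpha> * (\<Prod>i\<in>UNIV. (x $ i) ^ \<alpha> i))}"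

definition C0 :: "(real^'d) set \<Rightarrow> (real^'d \<Rightarrow> real) set" where
  "C0 \<Omega> = {v. continuous_on (closure \<Omega>) v}"

text \<open>Elements are total functions whose values outside \<open>closure \<Omega>\<close> are irrelevant.\<close>

definition V_h :: "(real^'d) set \<Rightarrow> (real^'d) set set \<Rightarrow> nat \<Rightarrow> (real^'d \<Rightarrow> real) set" where
  "V_h \<Omega> \<T> k = {v \<in> C0 \<Omega> \<inter> H1_space \<Omega>. \<forall>T\<in>\<T>. \<exists>p\<in>poly_space k. \<forall>x\<in>T. v x = p x}"

text \<open>The projection is unique on \<open>closure \<Omega>\<close>; the choice only concerns values outside it.\<close>

definition L2_proj ::
  "(real^'d) set \<Rightarrow> (real^'d \<Rightarrow> real) set \<Rightarrow> (real^'d \<Rightarrow> real) \<Rightarrow> real^'d \<Rightarrow> real" where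
  "L2_proj \<Omega> W f = (SOME w. w \<in> W \<and> (\<forall>\<phi>\<in>W. L2_inner \<Omega> (\<lambda>x. f x - w x) \<phi> = 0))"

text \<open>Derivatives at end points of \<open>I\<close> belonging to \<open>I\<close> are one-sided.\<close>

definition C1_on_interval :: "real set \<Rightarrow> (real \<Rightarrow> real) \<Rightarrow> (real \<Rightarrow> real) \<Rightarrow> bool" where
  "C1_on_interval I F F' \<longleftrightarrow> is_interval I \<and>
     (\<forall>s\<in>I. (F has_real_derivative F' s) (at s within I)) \<and> continuous_on I F'"

definition H_fun :: "(real \<Rightarrow> real) \<Rightarrow> (real \<Rightarrow> real) \<Rightarrow> real \<Rightarrow> real \<Rightarrow> real" where
  "H_fun F F' B w = F' w / sqrt (F w + B)"

definition energy ::
  "(real^'d) set \<Rightarrow> real \<Rightarrow> real \<Rightarrow> (real^'d \<Rightarrow> real) \<Rightarrow> (real^'d \<Rightarrow> real) \<Rightarrow> real" where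
  "energy \<Omega> \<epsilon> B v V = 1/2 * A_form \<Omega> (\<lambda>_. \<epsilon>\<^sup>2) v v + (LINT x:\<Omega>|lebesgue. (V x)\<^sup>2)
                      - B * measure lebesgue \<Omega>"

definition extrapolate :: "(real^'d \<Rightarrow> real) \<Rightarrow> (real^'d \<Rightarrow> real) \<Rightarrow> real^'d \<Rightarrow> real" where
  "extrapolate u0 u1 = (\<lambda>x. 3/2 * u1 x - 1/2 * u0 x)"

text \<open>\<open>u0, u1, u2\<close> are the discrete solutions at the levels \<open>n - 1, n, n + 1\<close>, and \<open>U1, U2\<close> the
  auxiliary variables at the levels \<open>n, n + 1\<close>.\<close>

definition scheme_step ::
  "(real^'d) set \<Rightarrow> (real^'d) set set \<Rightarrow> nat \<Rightarrow> real \<Rightarrow> (real \<Rightarrow> real) \<Rightarrow> real \<Rightarrow>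
   (real^'d \<Rightarrow> real) \<Rightarrow> (real^'d \<Rightarrow> real) \<Rightarrow> (real^'d \<Rightarrow> real) \<Rightarrow>
   (real^'d \<Rightarrow> real) \<Rightarrow> (real^'d \<Rightarrow> real) \<Rightarrow> bool" where
  "scheme_step \<Omega> \<T> k \<epsilon> H \<Delta>t u0 u1 U1 u2 U2 \<longleftrightarrow>
     u2 \<in> V_h \<Omega> \<T> k \<and> U2 \<in> C0 \<Omega> \<and>
     (let us = extrapolate u0 u1;
          U1h = L2_proj \<Omega> (V_h \<Omega> \<T> k) U1;
          um = (\<lambda>x. 1/2 * (u1 x + u2 x));
          Um = (\<lambda>x. 1/2 * (U2 x + U1h x))
      in (\<forall>\<phi>\<in>V_h \<Omega> \<T> k.
            L2_inner \<Omega> (\<lambda>x. (um x - u1 x) / (1/2 * \<Delta>t)) \<phi> =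
              - A_form \<Omega> (\<lambda>_. \<epsilon>\<^sup>2) um \<phi> - L2_inner \<Omega> (\<lambda>x. H (us x) * Um x) \<phi>) \<and>
         (\<forall>x\<in>closure \<Omega>.
            (Um x - U1h x) / (1/2 * \<Delta>t) = 1/2 * H (us x) * ((um x - u1 x) / (1/2 * \<Delta>t))))"

end

theory Submission
  imports Defs
begin

text \<open>
  Write \<open>\<eta>\<close> for \<open>H\<close> at the extrapolated state, \<open>Uh\<close> for the projection of the old auxiliary variable,
  and \<open>d\<close> for the difference between the midpoint value and the old value of \<open>u\<close>. The pointwise equation
  of the scheme gives the new auxiliary variable explicitly as \<open>Uh + \<eta> d\<close>. What remains
  is one linear equation for \<open>d\<close> in \<open>V_h\<close> whose bilinear form
  \<open>(2 / \<Delta>t) (d, \<phi>) + A(\<epsilon>\<^sup>2; d, \<phi>) + (\<eta> d, \<eta> \<phi>) / 2\<close>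
  is symmetric and, because of its first term, positive definite on the closure of \<open>\<Omega>\<close> (\<open>scheme_step_iff\<close>,
  \<open>step_form_definite\<close>). As \<open>V_h\<close> is finite-dimensional on the closure of \<open>\<Omega>\<close>, this equation has
  exactly one solution there for every \<open>\<Delta>t > 0\<close> (\<open>step_form_solvable\<close>,
  \<open>step_solution_unique\<close>). The new auxiliary variable is continuous since \<open>\<eta>\<close>, \<open>Uh\<close> and \<open>d\<close> are.

  The equality in the energy law is the weak equation tested with \<open>d\<close>: the gradient term telescopes because
  of the midpoint, and the nonlinear term becomes the difference of the squares of the auxiliary
  variables because of the pointwise equation (\<open>energy_identity\<close>). The inequality holds because
  an orthogonal projection does not increase the norm (\<open>L2_norm_projection_le\<close>).

  Two foundations need an argument. First, the form \<open>A\<close> is defined through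
  one arbitrarily chosen weak gradient per function, so its bilinearity rests on weak gradients
  being unique almost everywhere (\<open>weak_gradient_unique\<close>), that is, on the fundamental lemma of the
  calculus of variations and on a sufficient supply of smooth functions with compact support.
  Second, \<open>V_h\<close> consists of total functions, of which only the values on the closure of \<open>\<Omega>\<close>
  matter. Existence is therefore obtained from a Riesz representation theorem for
  spaces of functions that are determined by finitely many point values (\<open>riesz_finite_points\<close>),
  and piecewise polynomials on a finite mesh form such a space (\<open>V_h_unisolvent\<close>).
\<close>

section \<open>Riesz representation on spaces determined by finitely many points\<close>

text \<open>Subspaces and linear functionals are expressed on sets of plain functions, each by one combined
  closure rule, because \<open>V_h\<close> is a set of total functions and not a type of its own.\<close>

definition lin_closed :: "('a \<Rightarrow> real) set \<Rightarrow> bool" where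
  "lin_closed W \<longleftrightarrow> (\<lambda>x. 0) \<in> W \<and> (\<forall>u\<in>W. \<forall>v\<in>W. \<forall>c. (\<lambda>x. u x + c * v x) \<in> W)"

lemma lin_closedD:
  assumes "lin_closed W"
  shows "(\<lambda>x. 0) \<in> W" "u \<in> W \<Longrightarrow> v \<in> W \<Longrightarrow> (\<lambda>x. u x + c * v x) \<in> W"
  using assms by (auto simp: lin_closed_def)

lemma lin_closed_combo:
  assumes W: "lin_closed W" and "u \<in> W" "v \<in> W"
  shows "(\<lambda>x. a * u x + b * v x) \<in> W"
proof -
  have "(\<lambda>x. 0 + a * u x) \<in> W" by (intro lin_closedD[OF W] assms)
  then have "(\<lambda>x. (0 + a * u x) + b * v x) \<in> W" by (intro lin_closedD[OF W] assms)
  then show ?thesis by simp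
qed

definition lin_fun :: "('a \<Rightarrow> real) set \<Rightarrow> (('a \<Rightarrow> real) \<Rightarrow> real) \<Rightarrow> bool" where
  "lin_fun W l \<longleftrightarrow> (\<forall>u\<in>W. \<forall>v\<in>W. \<forall>c. l (\<lambda>x. u x + c * v x) = l u + c * l v)"

lemma lin_funD:
  "lin_fun W l \<Longrightarrow> u \<in> W \<Longrightarrow> v \<in> W \<Longrightarrow> l (\<lambda>x. u x + c * v x) = l u + c * l v"
  by (auto simp: lin_fun_def)

lemma lin_fun_zero:
  assumes "lin_closed W" "lin_fun W l" shows "l (\<lambda>x. 0) = 0"
  using lin_funD[OF assms(2) lin_closedD(1)[OF assms(1)] lin_closedD(1)[OF assms(1)], of 1] by simp

text \<open>A finite-dimensional space of functions on \<open>X\<close> is determined by finitely many point values.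
  When a generator \<open>G i\<close> is added to a family that the points \<open>P\<close> already separate, either \<open>P\<close>
  still suffices, or some combination with coefficient \<open>1\<close> at \<open>G i\<close> vanishes on \<open>P\<close> but not at some
  \<open>x0\<close>; one more point \<open>x0\<close> then suffices, since up to the old family all combinations are multiples
  of that one. Point values are linear in the function, whereas choosing coefficients with
  respect to \<open>G\<close> is not, unless \<open>G\<close> is independent.\<close>

lemma unisolvent_points:
  fixes G :: "'i \<Rightarrow> 'a \<Rightarrow> real"
  assumes "finite J"
  shows "\<exists>P. finite P \<and> P \<subseteq> X \<and>
    (\<forall>c. (\<forall>x\<in>P. (\<Sum>j\<in>J. c j * G j x) = 0) \<longrightarrow> (\<forall>x\<in>X. (\<Sum>j\<in>J. c j * G j x) = 0))"
  using assms
proof (induction J rule: finite_induct)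
  case empty
  show ?case by auto
next
  case (insert i J)
  let ?S = "\<lambda>c x. \<Sum>j\<in>J. c j * G j x"
  obtain P where P: "finite P" "P \<subseteq> X"
    and uni: "\<And>c. (\<forall>x\<in>P. ?S c x = 0) \<Longrightarrow> (\<forall>x\<in>X. ?S c x = 0)"
    using insert.IH by blast
  have sum_insert: "(\<Sum>j\<in>insert i J. c j * G j x) = c i * G i x + ?S c x" for c x
    using insert.hyps by simp
  show ?case
  proof (cases "\<exists>b x. (\<forall>y\<in>P. G i y + ?S b y = 0) \<and> x \<in> X \<and> G i x + ?S b x \<noteq> 0")
    case True
    then obtain b x0 where b: "\<And>y. y \<in> P \<Longrightarrow> G i y + ?S b y = 0"
      and x0: "x0 \<in> X" "G i x0 + ?S b x0 \<noteq> 0" by blast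
    \<comment> \<open>Subtracting \<open>c i\<close> times the exceptional combination removes \<open>G i\<close>, so the old points apply.\<close>
    have "\<forall>x\<in>X. c i * G i x + ?S c x = 0"
      if c: "\<forall>x\<in>insert x0 P. c i * G i x + ?S c x = 0" for c
    proof -
      have diff: "?S (\<lambda>j. c j - c i * b j) x = ?S c x - c i * ?S b x" for x
        by (simp add: sum_distrib_left algebra_simps sum_subtractf)
      have "?S (\<lambda>j. c j - c i * b j) y = 0" if y: "y \<in> P" for y
      proof -
        have "?S c y = - c i * G i y" using c y by (simp add: add_eq_0_iff2)
        moreover have "?S b y = - G i y" using b[OF y] by simp
        ultimately show ?thesis unfolding diff by simp
      qed
      then have eq: "?S c x = c i * ?S b x" if "x \<in> X" for x
        using uni[of "\<lambda>j. c j - c i * b j"] diff that by auto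
      have "c i * (G i x0 + ?S b x0) = 0"
        using c eq[OF x0(1)] by (simp add: algebra_simps)
      then have "c i = 0" using x0(2) by simp
      then show ?thesis using eq by simp
    qed
    then show ?thesis unfolding sum_insert
      using P x0(1) by (intro exI[of _ "insert x0 P"] conjI allI impI) blast+
  next
    case False
    then have no: "G i x + ?S b x = 0" if "\<forall>y\<in>P. G i y + ?S b y = 0" "x \<in> X" for b x
      using that by blast
    have "\<forall>x\<in>X. c i * G i x + ?S c x = 0"
      if c: "\<forall>x\<in>P. c i * G i x + ?S c x = 0" for c
    proof (cases "c i = 0")
      case True
      then show ?thesis using c uni[of c] by simp
    next
      case nz: False
      have div: "?S (\<lambda>j. c j / c i) x = ?S c x / c i" for x
        by (simp add: sum_divide_distrib)
      have "\<forall>y\<in>P. G i y + ?S (\<lambda>j. c j / c i) y = 0"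
      proof
        fix y assume "y \<in> P"
        then show "G i y + ?S (\<lambda>j. c j / c i) y = 0"
          using bspec[OF c] nz unfolding div by (simp add: field_simps)
      qed
      then have "G i x + ?S (\<lambda>j. c j / c i) x = 0" if "x \<in> X" for x
        using no[of "\<lambda>j. c j / c i"] that by simp
      then show ?thesis using nz unfolding div by (simp add: field_simps)
    qed
    then show ?thesis unfolding sum_insert
      using P by (intro exI[of _ P] conjI allI impI) blast+
  qed
qed

text \<open>Riesz representation for a symmetric bilinear form \<open>a\<close> on a space whose elements are, as far
  as \<open>a\<close> can see, determined by their values on a finite set \<open>P\<close>. Removing one point \<open>p\<close> from \<open>P\<close>
  corresponds to passing to the subspace \<open>W'\<close> of functions vanishing at \<open>p\<close>, which has codimension
  at most one. A complement of \<open>W'\<close> that is \<open>a\<close>-orthogonal to it is found by projecting onto \<open>W'\<close>,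
  and that projection is itself an instance of the induction hypothesis. The form may vanish on
  nonzero functions, such as those supported outside the domain, and the hypotheses
  on \<open>a v v = 0\<close> say that such functions are invisible to \<open>a\<close> and \<open>l\<close>.\<close>

lemma riesz_finite_points:
  fixes a :: "('a \<Rightarrow> real) \<Rightarrow> ('a \<Rightarrow> real) \<Rightarrow> real"
  assumes "finite P" and "lin_closed W"
    and "\<And>v. v \<in> W \<Longrightarrow> lin_fun W (a v)" "\<And>u v. u \<in> W \<Longrightarrow> v \<in> W \<Longrightarrow> a u v = a v u"
    and "lin_fun W l"
    and "\<And>v. v \<in> W \<Longrightarrow> a v v = 0 \<Longrightarrow> l v = 0"
    and "\<And>u v. u \<in> W \<Longrightarrow> v \<in> W \<Longrightarrow> a v v = 0 \<Longrightarrow> a u v = 0"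
    and "\<And>v. v \<in> W \<Longrightarrow> \<forall>x\<in>P. v x = 0 \<Longrightarrow> a v v = 0"
  shows "\<exists>u\<in>W. \<forall>v\<in>W. a u v = l v"
  using assms
proof (induction P arbitrary: W l rule: finite_induct)
  case (empty W l)
  have "a v v = 0" if "v \<in> W" for v using empty.prems(7) that by simp
  then show ?case
    using empty.prems(5,6) lin_closedD(1)[OF empty.prems(1)] by (intro bexI[of _ "\<lambda>x. 0"]) auto
next
  case (insert p P W l)
  note W = insert.prems(1) and lin = insert.prems(2) and sym = insert.prems(3)
    and l = insert.prems(4) and l_null = insert.prems(5) and a_null = insert.prems(6)
    and def = insert.prems(7)
  define W' where "W' = {v\<in>W. v p = 0}"
  have sub: "W' \<subseteq> W" by (auto simp: W'_def)
  have W': "lin_closed W'"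
    using W by (auto simp: lin_closed_def W'_def)
  have linW': "lin_fun W' m" if "lin_fun W m" for m
    using that sub unfolding lin_fun_def by blast
  have IH: "\<exists>u\<in>W'. \<forall>v\<in>W'. a u v = m v"
    if "lin_fun W m" "\<And>v. v \<in> W \<Longrightarrow> a v v = 0 \<Longrightarrow> m v = 0" for m
  proof (rule insert.IH[of W' m])
    show "a v v = 0" if "v \<in> W'" "\<forall>x\<in>P. v x = 0" for v
      using def[of v] that by (auto simp: W'_def)
    show "lin_fun W' (a v)" if "v \<in> W'" for v using linW' lin that sub by blast
    show "a u v = a v u" if "u \<in> W'" "v \<in> W'" for u v
      using sym[of u v] that sub by (simp add: subset_iff)
    show "a u v = 0" if "u \<in> W'" "v \<in> W'" "a v v = 0" for u v
      using a_null[of u v] that sub by (simp add: subset_iff)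
    show "m v = 0" if "v \<in> W'" "a v v = 0" for v
      using \<open>\<And>v. v \<in> W \<Longrightarrow> a v v = 0 \<Longrightarrow> m v = 0\<close>[of v] that sub by (simp add: subset_iff)
  qed (fact W', fact linW'[OF that(1)])
  obtain u0 where u0: "u0 \<in> W'" "\<And>v. v \<in> W' \<Longrightarrow> a u0 v = l v"
    using IH[OF l l_null] by blast
  show ?case
  proof (cases "W' = W")
    case True
    then show ?thesis using u0 by blast
  next
    case False
    then obtain z where z: "z \<in> W" "z p \<noteq> 0" by (auto simp: W'_def)
    obtain z' where z': "z' \<in> W'" "\<And>v. v \<in> W' \<Longrightarrow> a z' v = a z v"
      using IH[OF lin[OF z(1)] a_null[OF z(1)]] by blast
    define e where "e = (\<lambda>x. z x + (-1) * z' x)"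
    have e: "e \<in> W" unfolding e_def using z z' sub by (intro lin_closedD[OF W]) auto
    have ep: "e p \<noteq> 0" using z z' by (simp add: e_def W'_def)
    have orth: "a v e = 0" if v: "v \<in> W'" for v
    proof -
      have "a v e = a v z + (-1) * a v z'" unfolding e_def
        using v z z' sub by (intro lin_funD[OF lin]) auto
      then show ?thesis
        using z'(2)[OF v] sym[OF subsetD[OF sub v] z(1)] sym[OF subsetD[OF sub v] subsetD[OF sub z'(1)]]
        by simp
    qed
    \<comment> \<open>If \<open>e\<close> is a null vector of \<open>a\<close>, then \<open>l e = 0\<close> and no correction along \<open>e\<close> is needed.\<close>
    define t where "t = (if a e e = 0 then 0 else l e / a e e)"
    define u where "u = (\<lambda>x. u0 x + t * e x)"
    have u0W: "u0 \<in> W" using u0 sub by auto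
    have u: "u \<in> W" unfolding u_def by (intro lin_closedD[OF W] u0W e)
    have au: "a u v = a u0 v + t * a e v" if v: "v \<in> W" for v
    proof -
      have "a u v = a v u" by (rule sym[OF u v])
      also have "\<dots> = a v u0 + t * a v e" unfolding u_def by (rule lin_funD[OF lin[OF v] u0W e])
      finally show ?thesis using sym[OF v u0W] sym[OF v e] by simp
    qed
    have on_e: "a u e = l e"
      using au[OF e] orth[OF u0(1)] l_null[OF e] by (auto simp: t_def)
    have on_W': "a u v = l v" if v: "v \<in> W'" for v
    proof -
      have "a e v = 0" using sym[OF e subsetD[OF sub v]] orth[OF v] by simp
      then show ?thesis using au[OF subsetD[OF sub v]] u0(2)[OF v] by simp
    qed
    have "a u v = l v" if v: "v \<in> W" for v
    proof -
      let ?c = "v p / e p"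
      define w where "w = (\<lambda>x. v x + (- ?c) * e x)"
      have w: "w \<in> W'" using lin_closedD(2)[OF W v e, of "- ?c"] ep by (simp add: W'_def w_def)
      have v_eq: "v = (\<lambda>x. w x + ?c * e x)" by (auto simp: w_def)
      have "a u v = a u w + ?c * a u e"
        by (subst v_eq) (rule lin_funD[OF lin[OF u] subsetD[OF sub w] e])
      moreover have "l v = l w + ?c * l e"
        by (subst v_eq) (rule lin_funD[OF l subsetD[OF sub w] e])
      ultimately show ?thesis using on_e on_W'[OF w] by simp
    qed
    then show ?thesis using u by blast
  qed
qed

section \<open>Smooth functions approximating the indicator of a box\<close>

text \<open>The functions \<open>exp (- 1 / t) / t ^ n\<close>, extended by \<open>0\<close> to \<open>t \<le> 0\<close>. The powers of \<open>t\<close> are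
  included because the linear span of the whole family is closed under differentiation.\<close>

definition flat_exp :: "nat \<Rightarrow> real \<Rightarrow> real" where
  "flat_exp n t = (if t > 0 then exp (- 1 / t) / t ^ n else 0)"

lemma flat_exp_tendsto_0: "(flat_exp n \<longlongrightarrow> 0) (at 0)"
proof -
  have "((\<lambda>t. exp (- 1 / t) / t ^ n) \<longlongrightarrow> 0) (at_right (0::real))"
  proof -
    have "((\<lambda>s. s ^ n / exp s) \<longlongrightarrow> 0) (at_top :: real filter)"
      by (rule tendsto_power_div_exp_0)
    then have "((\<lambda>t. inverse t ^ n / exp (inverse t)) \<longlongrightarrow> 0) (at_right (0::real))"
      by (rule filterlim_compose[OF _ filterlim_inverse_at_top_right])
    then show ?thesis
      by (simp add: exp_minus field_simps power_inverse)
  qed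
  then have "(flat_exp n \<longlongrightarrow> 0) (at_right 0)"
    by (rule Lim_transform_eventually)
       (auto simp: flat_exp_def eventually_at_filter intro!: always_eventually)
  moreover have "(flat_exp n \<longlongrightarrow> 0) (at_left 0)"
    by (rule tendsto_eventually) (auto simp: flat_exp_def eventually_at_filter intro!: always_eventually)
  ultimately show ?thesis by (rule filterlim_split_at_real[rotated])
qed

lemma DERIV_flat_exp:
  "(flat_exp n has_real_derivative (flat_exp (n + 2) t - real n * flat_exp (n + 1) t)) (at t)"
proof (cases t "0::real" rule: linorder_cases)
  case less
  have "((\<lambda>x. 0) has_real_derivative 0) (at t)" by simp
  then have "(flat_exp n has_real_derivative 0) (at t)"
    by (rule has_field_derivative_transform_within_open[of _ _ _ "{..<0}"])
       (use less in \<open>auto simp: flat_exp_def\<close>)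
  then show ?thesis using less by (simp add: flat_exp_def)
next
  case greater
  have e: "((\<lambda>x. exp (- 1 / x)) has_real_derivative exp (- 1 / t) * inverse t ^ 2) (at t)"
    using greater by (auto intro!: derivative_eq_intros simp: field_simps power2_eq_square)
  have p: "((\<lambda>x. inverse x ^ n) has_real_derivative (- real n * inverse t ^ Suc n)) (at t)"
  proof (rule DERIV_cong)
    show "((\<lambda>x. inverse x ^ n) has_real_derivative
        real n * (- (inverse t ^ Suc (Suc 0)) * inverse t ^ (n - Suc 0))) (at t)"
      using DERIV_power[OF DERIV_inverse[of t UNIV], of n] greater by simp
    show "real n * (- (inverse t ^ Suc (Suc 0)) * inverse t ^ (n - Suc 0)) = - real n * inverse t ^ Suc n"
      by (cases n) (simp_all add: algebra_simps)
  qed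
  have "((\<lambda>x. exp (- 1 / x) * inverse x ^ n) has_real_derivative
      (exp (- 1 / t) / t ^ (n + 2) - real n * (exp (- 1 / t) / t ^ (n + 1)))) (at t)"
    using DERIV_mult[OF e p] greater
    by (simp add: power_inverse divide_inverse algebra_simps power_add power2_eq_square)
  then have "(flat_exp n has_real_derivative
      (exp (- 1 / t) / t ^ (n + 2) - real n * (exp (- 1 / t) / t ^ (n + 1)))) (at t)"
    by (rule has_field_derivative_transform_within_open[of _ _ _ "{0<..}"])
       (use greater in \<open>auto simp: flat_exp_def field_simps power_inverse\<close>)
  then show ?thesis using greater by (simp add: flat_exp_def)
next
  case equal
  \<comment> \<open>The difference quotient at \<open>0\<close> is the next member \<open>flat_exp (Suc n)\<close> of the family.\<close>
  have "((\<lambda>h. (flat_exp n (0 + h) - flat_exp n 0) / h) \<longlongrightarrow> 0) (at 0)"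
    by (rule Lim_transform_eventually[OF flat_exp_tendsto_0[of "Suc n"]])
       (auto simp: flat_exp_def eventually_at_filter intro!: always_eventually)
  then show ?thesis using equal by (simp add: DERIV_def flat_exp_def)
qed

text \<open>An algebra of functions on \<open>real^'d\<close> that contains the mollified box indicators used below and
  all their partial derivatives. Infinite differentiability of its members then needs no Leibniz
  formula for higher derivatives: it suffices that each member is differentiable with first
  partial derivatives in the algebra.\<close>

inductive_set bump_algebra :: "(real^'d \<Rightarrow> real) set" where
  const: "(\<lambda>x. c) \<in> bump_algebra"
| base: "(\<lambda>x. flat_exp n (a + b * x $ i)) \<in> bump_algebra"
| add: "f \<in> bump_algebra \<Longrightarrow> g \<in> bump_algebra \<Longrightarrow> (\<lambda>x. f x + g x) \<in> bump_algebra"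
| mult: "f \<in> bump_algebra \<Longrightarrow> g \<in> bump_algebra \<Longrightarrow> (\<lambda>x. f x * g x) \<in> bump_algebra"

lemma partial_deriv_eqI:
  "(f has_derivative f') (at x) \<Longrightarrow> partial_deriv i f x = f' (axis i 1)"
  unfolding partial_deriv_def by (simp add: frechet_derivative_at[symmetric])

lemma bump_algebra_deriv:
  fixes f :: "real^'d \<Rightarrow> real"
  assumes "f \<in> bump_algebra"
  shows "(\<forall>x. f differentiable at x) \<and> (\<forall>i. partial_deriv i f \<in> bump_algebra)"
  using assms
proof (induction rule: bump_algebra.induct)
  case (const c)
  have "partial_deriv i (\<lambda>x::real^'d. c) = (\<lambda>x. 0)" for i
    by (rule ext, subst partial_deriv_eqI[OF has_derivative_const]) simp
  then show ?case by (auto intro: bump_algebra.const)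
next
  case (base n a b i)
  define D where "D t = flat_exp (n + 2) t + (- real n) * flat_exp (n + 1) t" for t
  have der: "((\<lambda>x::real^'d. flat_exp n (a + b * x $ i)) has_derivative
      (\<lambda>h. D (a + b * x $ i) * (b * h $ i))) (at x)" for x
  proof -
    have 1: "((\<lambda>x::real^'d. a + b * x $ i) has_derivative (\<lambda>h. b * h $ i)) (at x)"
      by (auto intro!: derivative_eq_intros bounded_linear.has_derivative[OF bounded_linear_vec_nth])
    have 2: "(flat_exp n has_derivative (\<lambda>h. D (a + b * x $ i) * h)) (at (a + b * x $ i))"
      using DERIV_flat_exp[of n "a + b * x $ i"] by (simp add: has_field_derivative_def D_def)
    show ?thesis using diff_chain_at[OF 1 2] by (simp add: o_def)
  qed
  have pd: "partial_deriv j (\<lambda>x::real^'d. flat_exp n (a + b * x $ i)) =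
      (\<lambda>x. D (a + b * x $ i) * (b * axis j 1 $ i))" for j
    by (rule ext) (rule partial_deriv_eqI[OF der])
  have "(\<lambda>x. D (a + b * x $ i) * (b * axis j 1 $ i)) \<in> bump_algebra" for j
    unfolding D_def by (intro bump_algebra.intros)
  then show ?case
    unfolding pd using der by (auto simp: differentiable_def)
next
  case (add f g)
  have pd: "partial_deriv i (\<lambda>x. f x + g x) = (\<lambda>x. partial_deriv i f x + partial_deriv i g x)" for i
  proof
    fix x
    have "((\<lambda>x. f x + g x) has_derivative
        (\<lambda>h. frechet_derivative f (at x) h + frechet_derivative g (at x) h)) (at x)"
      using add.IH by (intro has_derivative_add) (auto simp: frechet_derivative_works)
    from partial_deriv_eqI[OF this, of i]
    show "partial_deriv i (\<lambda>x. f x + g x) x = partial_deriv i f x + partial_deriv i g x"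
      by (simp add: partial_deriv_def)
  qed
  show ?case unfolding pd using add by (auto intro: bump_algebra.add)
next
  case (mult f g)
  have pd: "partial_deriv i (\<lambda>x. f x * g x) =
      (\<lambda>x. f x * partial_deriv i g x + partial_deriv i f x * g x)" for i
  proof
    fix x
    have "((\<lambda>x. f x * g x) has_derivative
        (\<lambda>h. f x * frechet_derivative g (at x) h + frechet_derivative f (at x) h * g x)) (at x)"
      using mult.IH by (intro has_derivative_mult) (auto simp: frechet_derivative_works)
    from partial_deriv_eqI[OF this, of i]
    show "partial_deriv i (\<lambda>x. f x * g x) x = f x * partial_deriv i g x + partial_deriv i f x * g x"
      by (simp add: partial_deriv_def)
  qed
  show ?case unfolding pd using mult by (auto intro!: bump_algebra.add bump_algebra.mult)
qed

lemma bump_algebra_C_k: "f \<in> bump_algebra \<Longrightarrow> C_k m f"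
proof (induction m arbitrary: f)
  case 0
  then show ?case using bump_algebra_deriv[OF 0]
    by (auto simp: continuous_on_eq_continuous_at intro: differentiable_imp_continuous_within)
next
  case (Suc m)
  then show ?case using bump_algebra_deriv[OF Suc.prems] by simp
qed

lemma bump_algebra_prod:
  "finite A \<Longrightarrow> (\<And>i. i \<in> A \<Longrightarrow> f i \<in> bump_algebra) \<Longrightarrow> (\<lambda>x. \<Prod>i\<in>A. f i x) \<in> bump_algebra"
proof (induction A rule: finite_induct)
  case empty
  show ?case by (simp add: bump_algebra.const)
next
  case (insert i A)
  then show ?case by (simp add: bump_algebra.mult)
qed

text \<open>As the index tends to infinity, each factor \<open>exp (- 1 / ((m + 1) s))\<close> with \<open>s > 0\<close> tends
  to \<open>1\<close>, so these functions tend to the indicator of the open box while staying between \<open>0\<close>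
  and \<open>1\<close>.\<close>

definition box_bump :: "real^'d \<Rightarrow> real^'d \<Rightarrow> nat \<Rightarrow> real^'d \<Rightarrow> real" where
  "box_bump a b m x = (\<Prod>i\<in>UNIV. flat_exp 0 (real (Suc m) * (x $ i - a $ i)) *
                                 flat_exp 0 (real (Suc m) * (b $ i - x $ i)))"

lemma flat_exp_0_bounds: "0 \<le> flat_exp 0 t" "flat_exp 0 t \<le> 1"
  by (auto simp: flat_exp_def)

lemma box_bump_bounds: "0 \<le> box_bump a b m x" "box_bump a b m x \<le> 1"
  unfolding box_bump_def
  by (auto intro!: prod_nonneg prod_le_1 mult_nonneg_nonneg mult_le_one simp: flat_exp_0_bounds)

lemma box_bump_outside: "x \<notin> box a b \<Longrightarrow> box_bump a b m x = 0"
  by (auto simp: box_bump_def mem_box_cart flat_exp_def zero_less_mult_iff prod_zero_iff)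

lemma box_bump_tendsto: "(\<lambda>m. box_bump a b m x) \<longlonglongrightarrow> indicator (box a b) x"
proof (cases "x \<in> box a b")
  case True
  have one: "(\<lambda>m. flat_exp 0 (real (Suc m) * t)) \<longlonglongrightarrow> 1" if "t > 0" for t
  proof -
    have "(\<lambda>m. exp (- (1 / t) * inverse (real (Suc m)))) \<longlonglongrightarrow> exp (- (1 / t) * 0)"
      by (intro tendsto_intros LIMSEQ_inverse_real_of_nat)
    moreover have "flat_exp 0 (real (Suc m) * t) = exp (- (1 / t) * inverse (real (Suc m)))" for m
      using that by (simp add: flat_exp_def divide_inverse)
    ultimately show ?thesis by simp
  qed
  have "(\<lambda>m. box_bump a b m x) \<longlonglongrightarrow> (\<Prod>i\<in>(UNIV::'a set). 1 * 1)"
    unfolding box_bump_def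
    using True by (intro tendsto_prod tendsto_mult one) (auto simp: mem_box_cart)
  then show ?thesis using True by simp
next
  case False
  then show ?thesis by (simp add: box_bump_outside)
qed

lemma box_bump_test_function:
  fixes a b :: "real^'d"
  assumes "cbox a b \<subseteq> \<Omega>"
  shows "box_bump a b m \<in> test_functions \<Omega>"
proof -
  let ?m = "real (Suc m)"
  have "flat_exp 0 (?m * (x $ i - a $ i)) = flat_exp 0 (- ?m * a $ i + ?m * x $ i)"
    "flat_exp 0 (?m * (b $ i - x $ i)) = flat_exp 0 (?m * b $ i + (- ?m) * x $ i)" for x i
    by (simp_all add: algebra_simps)
  then have "box_bump a b m \<in> bump_algebra"
    unfolding box_bump_def [abs_def]
    by (simp only:) (intro bump_algebra_prod bump_algebra.mult bump_algebra.base finite)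
  moreover have "bounded {x. box_bump a b m x \<noteq> 0}"
    by (rule bounded_subset[OF bounded_box[of a b]]) (use box_bump_outside in blast)
  moreover have "closure {x. box_bump a b m x \<noteq> 0} \<subseteq> cbox a b"
    using box_bump_outside[of _ a b m] box_subset_cbox[of a b]
    by (intro closure_minimal) (auto simp: closed_cbox)
  ultimately show ?thesis
    using assms bump_algebra_C_k by (auto simp: test_functions_def compact_closure)
qed

section \<open>Square integrable functions and the fundamental lemma\<close>

lemma L2_inner_integrable:
  fixes f g :: "real^'d \<Rightarrow> 'b::euclidean_space"
  assumes f: "f \<in> L2_space \<Omega>" and g: "g \<in> L2_space \<Omega>"
  shows "set_integrable lebesgue \<Omega> (\<lambda>x. f x \<bullet> g x)"
proof (rule set_integrable_bound)
  show "set_integrable lebesgue \<Omega> (\<lambda>x. (norm (f x))\<^sup>2 + (norm (g x))\<^sup>2)"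
    using f g by (auto simp: L2_space_def)
  have [measurable]: "(\<lambda>x. indicator \<Omega> x *\<^sub>R f x) \<in> borel_measurable lebesgue"
    "(\<lambda>x. indicator \<Omega> x *\<^sub>R g x) \<in> borel_measurable lebesgue"
    using f g by (auto simp: L2_space_def set_borel_measurable_def)
  have "(\<lambda>x. (indicator \<Omega> x *\<^sub>R f x) \<bullet> (indicator \<Omega> x *\<^sub>R g x)) \<in> borel_measurable lebesgue"
    by measurable
  also have "(\<lambda>x. (indicator \<Omega> x *\<^sub>R f x) \<bullet> (indicator \<Omega> x *\<^sub>R g x)) =
      (\<lambda>x. indicator \<Omega> x *\<^sub>R (f x \<bullet> g x))"
    by (auto simp: indicator_def)
  finally show "set_borel_measurable lebesgue \<Omega> (\<lambda>x. f x \<bullet> g x)"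
    by (simp add: set_borel_measurable_def)
  have "\<bar>a \<bullet> b\<bar> \<le> (norm a)\<^sup>2 + (norm b)\<^sup>2" for a b :: 'b
  proof -
    have "\<bar>a \<bullet> b\<bar> \<le> norm a * norm b" by (rule Cauchy_Schwarz_ineq2)
    also have "\<dots> \<le> (norm a)\<^sup>2 + (norm b)\<^sup>2"
      using sum_squares_bound[of "norm a" "norm b"]
        mult_nonneg_nonneg[OF norm_ge_zero[of a] norm_ge_zero[of b]] by linarith
    finally show ?thesis .
  qed
  then show "AE x in lebesgue. x \<in> \<Omega> \<longrightarrow>
      norm (f x \<bullet> g x) \<le> norm ((norm (f x))\<^sup>2 + (norm (g x))\<^sup>2)"
    by simp
qed

lemma L2_space_lin:
  fixes f g :: "real^'d \<Rightarrow> 'b::euclidean_space"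
  assumes f: "f \<in> L2_space \<Omega>" and g: "g \<in> L2_space \<Omega>"
  shows "(\<lambda>x. f x + c *\<^sub>R g x) \<in> L2_space \<Omega>"
proof -
  have [measurable]: "(\<lambda>x. indicator \<Omega> x *\<^sub>R f x) \<in> borel_measurable lebesgue"
    "(\<lambda>x. indicator \<Omega> x *\<^sub>R g x) \<in> borel_measurable lebesgue"
    using f g by (auto simp: L2_space_def set_borel_measurable_def)
  have "(\<lambda>x. indicator \<Omega> x *\<^sub>R f x + c *\<^sub>R (indicator \<Omega> x *\<^sub>R g x)) \<in> borel_measurable lebesgue"
    by measurable
  then have "set_borel_measurable lebesgue \<Omega> (\<lambda>x. f x + c *\<^sub>R g x)"
    by (simp add: set_borel_measurable_def algebra_simps)
  moreover have "set_integrable lebesgue \<Omega>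
      (\<lambda>x. f x \<bullet> f x + 2 * c * (f x \<bullet> g x) + c\<^sup>2 * (g x \<bullet> g x))"
    using L2_inner_integrable[OF f f] L2_inner_integrable[OF f g] L2_inner_integrable[OF g g]
    by (intro set_integral_add set_integrable_mult_right)
  then have "set_integrable lebesgue \<Omega> (\<lambda>x. (norm (f x + c *\<^sub>R g x))\<^sup>2)"
    unfolding power2_norm_eq_inner
    by (simp add: inner_add_left inner_add_right inner_commute power2_eq_square algebra_simps)
  ultimately show ?thesis by (simp add: L2_space_def)
qed

lemma set_integrable_continuous_closure:
  fixes f :: "real^'d \<Rightarrow> 'b::euclidean_space"
  assumes \<Omega>: "open \<Omega>" "bounded \<Omega>" and f: "continuous_on (closure \<Omega>) f"
  shows "set_borel_measurable lebesgue \<Omega> f" "set_integrable lebesgue \<Omega> f"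
proof -
  have "(\<lambda>x. indicator \<Omega> x *\<^sub>R f x) \<in> borel_measurable borel"
    using continuous_on_subset[OF f closure_subset] \<Omega>(1)
    by (intro borel_measurable_continuous_on_indicator) auto
  then show m: "set_borel_measurable lebesgue \<Omega> f"
    unfolding set_borel_measurable_def by (simp add: measurable_completion)
  have "bounded (f ` closure \<Omega>)"
    using f \<Omega>(2) by (intro compact_imp_bounded compact_continuous_image) (auto simp: compact_closure)
  then obtain K where K: "\<And>x. x \<in> closure \<Omega> \<Longrightarrow> norm (f x) \<le> K"
    by (auto simp: bounded_iff)
  have const: "set_integrable lebesgue \<Omega> (\<lambda>x. K)"
    using lmeasurable_open[OF \<Omega>(2,1)]
    by (simp add: set_integrable_def lmeasurable_iff_integrable)
  have "norm (f x) \<le> norm K" if "x \<in> \<Omega>" for x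
    using K[of x] that closure_subset by force
  then show "set_integrable lebesgue \<Omega> f"
    by (intro set_integrable_bound[OF const m]) auto
qed

lemma continuous_in_L2_space:
  fixes f :: "real^'d \<Rightarrow> 'b::euclidean_space"
  assumes "open \<Omega>" "bounded \<Omega>" "continuous_on (closure \<Omega>) f"
  shows "f \<in> L2_space \<Omega>"
proof -
  have "continuous_on (closure \<Omega>) (\<lambda>x. (norm (f x))\<^sup>2)"
    by (intro continuous_intros assms)
  then show ?thesis
    using set_integrable_continuous_closure(1)[OF assms]
      set_integrable_continuous_closure(2)[OF assms(1,2)]
    by (simp add: L2_space_def)
qed

text \<open>A nonempty open set is not negligible, so a continuous function vanishing almost everywhere
  on \<open>\<Omega>\<close> has no zero-free open part there, and continuity carries the zero to the closure.\<close>

lemma AE_zero_imp_zero_on_closure: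
  fixes f :: "real^'d \<Rightarrow> real"
  assumes \<Omega>: "open \<Omega>" and f: "continuous_on (closure \<Omega>) f"
    and ae: "AE x in lebesgue. x \<in> \<Omega> \<longrightarrow> f x = 0" and x: "x \<in> closure \<Omega>"
  shows "f x = 0"
proof -
  define S where "S = \<Omega> \<inter> f -` (- {0})"
  have "open S" unfolding S_def
    using continuous_on_subset[OF f closure_subset] \<Omega> by (intro continuous_open_preimage) auto
  moreover have "negligible S"
  proof -
    obtain N where "{x\<in>space lebesgue. \<not> (x \<in> \<Omega> \<longrightarrow> f x = 0)} \<subseteq> N"
      "emeasure lebesgue N = 0" "N \<in> sets lebesgue"
      using ae by (rule AE_E)
    then have "negligible N" "S \<subseteq> N"
      by (auto simp: S_def negligible_iff_null_sets)
    then show ?thesis by (rule negligible_subset)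
  qed
  ultimately have "S = {}" using open_not_negligible by blast
  then have "f y = 0" if "y \<in> \<Omega>" for y using that by (auto simp: S_def)
  then show ?thesis
    using continuous_constant_on_closure[OF f _ x, of 0] by blast
qed

lemma L2_inner_self_eq_0D:
  assumes \<Omega>: "open \<Omega>" "bounded \<Omega>" and f: "continuous_on (closure \<Omega>) f"
    and 0: "L2_inner \<Omega> f f = 0" and x: "x \<in> closure \<Omega>"
  shows "f x = 0"
proof (rule AE_zero_imp_zero_on_closure[OF \<Omega>(1) f _ x])
  have "set_integrable lebesgue \<Omega> (\<lambda>x. f x * f x)"
    by (rule set_integrable_continuous_closure(2)[OF \<Omega>]) (intro continuous_intros f)
  then have "AE x in lebesgue. indicator \<Omega> x *\<^sub>R (f x * f x) = 0"
    using 0 unfolding set_integrable_def L2_inner_def set_lebesgue_integral_def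
    by (subst (asm) integral_nonneg_eq_0_iff_AE) auto
  then show "AE x in lebesgue. x \<in> \<Omega> \<longrightarrow> f x = 0"
    by eventually_elim (auto simp: indicator_def)
qed

text \<open>The fundamental lemma of the calculus of variations. Testing with \<open>box_bump\<close> and dominated
  convergence show that the integral of \<open>g\<close> over every box inside \<open>\<Omega>\<close> is zero; by Lebesgue
  differentiation, \<open>g\<close> is almost everywhere the limit of its averages over shrinking boxes.\<close>

lemma fundamental_lemma_calculus_of_variations:
  fixes g :: "real^'d \<Rightarrow> real"
  assumes \<Omega>: "open \<Omega>" and g: "set_integrable lebesgue \<Omega> g"
    and orth: "\<And>\<phi>. \<phi> \<in> test_functions \<Omega> \<Longrightarrow> (LINT x:\<Omega>|lebesgue. g x * \<phi> x) = 0"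
  shows "AE x in lebesgue. x \<in> \<Omega> \<longrightarrow> g x = 0"
proof -
  define G where "G = (\<lambda>x. indicator \<Omega> x * g x)"
  have G: "integrable lebesgue G"
    using g by (simp add: set_integrable_def G_def)
  then have [measurable]: "G \<in> borel_measurable lebesgue" by auto
  have box_int: "set_integrable lebesgue (cbox a b) G" for a b
    using integrable_mult_indicator[OF _ G, of "cbox a b"] by (simp add: set_integrable_def)
  have zero: "integral (cbox a b) G = 0" if ab: "cbox a b \<subseteq> \<Omega>" for a b
  proof -
    have bump: "(LINT x|lebesgue. box_bump a b m x * G x) = 0" for m
      using orth[OF box_bump_test_function[OF ab, of m]]
      by (simp add: set_lebesgue_integral_def G_def mult_ac)
    have [measurable]: "box_bump a b m \<in> borel_measurable lebesgue" for m
    proof -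
      have "continuous_on UNIV (box_bump a b m)"
        using box_bump_test_function[OF ab, of m] unfolding test_functions_def
        by (metis (no_types, lifting) C_k.simps(1) mem_Collect_eq)
      then show ?thesis by (intro measurable_completion) (auto intro: borel_measurable_continuous_onI)
    qed
    have "box a b \<in> sets lebesgue" by simp
    note [measurable] = this
    have "(\<lambda>m. LINT x|lebesgue. box_bump a b m x * G x) \<longlonglongrightarrow>
        (LINT x|lebesgue. indicator (box a b) x * G x)"
    proof (rule integral_dominated_convergence[where w = "\<lambda>x. norm (G x)"])
      show "AE x in lebesgue. (\<lambda>m. box_bump a b m x * G x) \<longlonglongrightarrow> indicator (box a b) x * G x"
        by (intro AE_I2 tendsto_mult box_bump_tendsto tendsto_const)
      show "AE x in lebesgue. norm (box_bump a b m x * G x) \<le> norm (G x)" for m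
        using box_bump_bounds[of a b m] by (auto simp: abs_mult intro!: mult_left_le_one_le)
    qed (use G in auto)
    then have "(LINT x|lebesgue. indicator (box a b) x * G x) = 0"
      by (simp add: bump LIMSEQ_const_iff)
    moreover have "set_integrable lebesgue (box a b) G"
      using integrable_mult_indicator[OF _ G, of "box a b"] by (simp add: set_integrable_def)
    from set_lebesgue_integral_eq_integral(2)[OF this]
    have "(LINT x|lebesgue. indicator (box a b) x * G x) = integral (box a b) G"
      by (simp add: set_lebesgue_integral_def)
    ultimately show ?thesis by (simp add: integral_open_interval)
  qed
  obtain N where N: "negligible N" and
    lim: "\<And>x e. \<lbrakk>x \<notin> N; 0 < e\<rbrakk> \<Longrightarrow> \<exists>d>0. \<forall>h. 0 < h \<and> h < d \<longrightarrow>
        norm (integral (cbox x (x + h *\<^sub>R One)) G /\<^sub>R h ^ DIM(real^'d) - G x) < e"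
    using integrable_ccontinuous_explicit[of G] set_lebesgue_integral_eq_integral(1)[OF box_int] by blast
  have "G x = 0" if x: "x \<in> \<Omega>" "x \<notin> N" for x
  proof (rule ccontr)
    assume nz: "G x \<noteq> 0"
    obtain d where d: "d > 0" "\<And>h. 0 < h \<Longrightarrow> h < d \<Longrightarrow>
        norm (integral (cbox x (x + h *\<^sub>R One)) G /\<^sub>R h ^ DIM(real^'d) - G x) < norm (G x)"
      using lim[OF x(2), of "norm (G x)"] nz by auto
    obtain r where r: "r > 0" "cball x r \<subseteq> \<Omega>"
      using \<Omega> x(1) open_contains_cball by blast
    define n where "n = norm (One :: real^'d)"
    \<comment> \<open>The side \<open>h\<close> is small enough for the limit and for the box to stay in the ball of radius \<open>r\<close>.\<close>
    define h where "h = min (d / 2) (r / (n + 1))"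
    have n: "n \<ge> 0" by (simp add: n_def)
    have h: "0 < h" "h < d" using d(1) r(1) n by (auto simp: h_def)
    have "h * n \<le> r / (n + 1) * n" using n by (intro mult_right_mono) (auto simp: h_def)
    also have "\<dots> \<le> r" using r(1) n by (simp add: field_simps)
    finally have hn: "h * n \<le> r" .
    have "cbox x (x + h *\<^sub>R One) \<subseteq> cball x r"
    proof
      fix y assume y: "y \<in> cbox x (x + h *\<^sub>R One)"
      have "norm (y - x) \<le> norm (h *\<^sub>R One :: real^'d)"
      proof (rule norm_le_componentwise)
        fix b :: "real^'d" assume b: "b \<in> Basis"
        have "x \<bullet> b \<le> y \<bullet> b" "y \<bullet> b \<le> x \<bullet> b + h * (One \<bullet> b)"
          using y b by (auto simp: mem_box inner_add_left)
        then show "\<bar>(y - x) \<bullet> b\<bar> \<le> \<bar>(h *\<^sub>R One) \<bullet> b\<bar>"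
          by (simp add: inner_diff_left)
      qed
      also have "\<dots> = h * n" using h by (simp add: n_def)
      finally show "y \<in> cball x r" using hn by (simp add: dist_norm norm_minus_commute)
    qed
    then have "integral (cbox x (x + h *\<^sub>R One)) G = 0" using r(2) by (intro zero) blast
    then show False using d(2)[OF h] by simp
  qed
  then have "AE x in lebesgue. x \<in> \<Omega> \<longrightarrow> G x = 0"
    using N by (intro AE_I'[of N]) (auto simp: negligible_iff_null_sets)
  then show ?thesis
    by eventually_elim (auto simp: G_def)
qed

section \<open>Weak gradients\<close>

lemma set_AE_cong_integral:
  fixes f g :: "real^'d \<Rightarrow> real"
  assumes "set_integrable lebesgue \<Omega> f" "set_integrable lebesgue \<Omega> g"
    and "AE x in lebesgue. x \<in> \<Omega> \<longrightarrow> f x = g x"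
  shows "(LINT x:\<Omega>|lebesgue. f x) = (LINT x:\<Omega>|lebesgue. g x)"
proof -
  have "AE x in lebesgue. indicator \<Omega> x *\<^sub>R f x = indicator \<Omega> x *\<^sub>R g x"
    using assms(3) by eventually_elim (auto simp: indicator_def)
  then show ?thesis
    using assms(1,2) unfolding set_lebesgue_integral_def set_integrable_def
    by (intro integral_cong_AE borel_measurable_integrable)
qed

lemma test_function_in_L2:
  fixes \<phi> :: "real^'d \<Rightarrow> real"
  assumes \<Omega>: "open \<Omega>" "bounded \<Omega>" and \<phi>: "\<phi> \<in> test_functions \<Omega>"
  shows "\<phi> \<in> L2_space \<Omega>" "partial_deriv i \<phi> \<in> L2_space \<Omega>"
proof -
  have "C_k 0 \<phi>" "C_k (Suc 0) \<phi>" using \<phi> unfolding test_functions_def by blast+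
  then have "continuous_on UNIV \<phi>" "continuous_on UNIV (partial_deriv i \<phi>)" by auto
  then show "\<phi> \<in> L2_space \<Omega>" "partial_deriv i \<phi> \<in> L2_space \<Omega>"
    using continuous_in_L2_space[OF \<Omega>] continuous_on_subset by blast+
qed

lemma L2_space_component:
  fixes g :: "real^'d \<Rightarrow> real^'d"
  assumes g: "g \<in> L2_space \<Omega>"
  shows "(\<lambda>x. g x $ i) \<in> L2_space \<Omega>"
proof -
  have [measurable]: "(\<lambda>x. indicator \<Omega> x *\<^sub>R g x) \<in> borel_measurable lebesgue"
    using g by (auto simp: L2_space_def set_borel_measurable_def)
  have "(\<lambda>x. (indicator \<Omega> x *\<^sub>R g x) \<bullet> axis i 1) \<in> borel_measurable lebesgue"
    by measurable
  then have m: "set_borel_measurable lebesgue \<Omega> (\<lambda>x. g x $ i)"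
    by (simp add: set_borel_measurable_def inner_axis)
  have "(\<lambda>x. (indicator \<Omega> x *\<^sub>R g x $ i) * (g x $ i)) =
      (\<lambda>x. (indicator \<Omega> x *\<^sub>R g x $ i) * (indicator \<Omega> x *\<^sub>R g x $ i))"
    by (auto simp: indicator_def)
  then have "set_borel_measurable lebesgue \<Omega> (\<lambda>x. (norm (g x $ i))\<^sup>2)"
    using borel_measurable_times[OF m[unfolded set_borel_measurable_def] m[unfolded set_borel_measurable_def]]
    by (simp add: set_borel_measurable_def power2_eq_square mult.assoc)
  moreover have "set_integrable lebesgue \<Omega> (\<lambda>x. (norm (g x))\<^sup>2)"
    using g by (simp add: L2_space_def)
  moreover have "(norm (g x $ i))\<^sup>2 \<le> (norm (g x))\<^sup>2" for x
    by (intro power_mono Finite_Cartesian_Product.norm_nth_le) auto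
  ultimately have "set_integrable lebesgue \<Omega> (\<lambda>x. (norm (g x $ i))\<^sup>2)"
    by - (rule set_integrable_bound, assumption+, simp)
  with m show ?thesis by (simp add: L2_space_def)
qed

lemma weak_gradient_lin:
  fixes v w :: "real^'d \<Rightarrow> real"
  assumes \<Omega>: "open \<Omega>" "bounded \<Omega>"
    and L2: "v \<in> L2_space \<Omega>" "w \<in> L2_space \<Omega>" "g \<in> L2_space \<Omega>" "h \<in> L2_space \<Omega>"
    and g: "is_weak_gradient \<Omega> v g" and h: "is_weak_gradient \<Omega> w h"
  shows "is_weak_gradient \<Omega> (\<lambda>x. v x + c * w x) (\<lambda>x. g x + c *\<^sub>R h x)"
  unfolding is_weak_gradient_def
proof (intro ballI allI)
  fix \<phi> :: "real^'d \<Rightarrow> real" and i :: 'd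
  assume \<phi>: "\<phi> \<in> test_functions \<Omega>"
  note T = test_function_in_L2[OF \<Omega> \<phi>]
  have int: "set_integrable lebesgue \<Omega> (\<lambda>x. v x * partial_deriv i \<phi> x)"
    "set_integrable lebesgue \<Omega> (\<lambda>x. w x * partial_deriv i \<phi> x)"
    "set_integrable lebesgue \<Omega> (\<lambda>x. g x $ i * \<phi> x)"
    "set_integrable lebesgue \<Omega> (\<lambda>x. h x $ i * \<phi> x)"
    using L2_inner_integrable[OF L2(1) T(2)[of i]] L2_inner_integrable[OF L2(2) T(2)[of i]]
      L2_inner_integrable[OF L2_space_component[OF L2(3)] T(1)]
      L2_inner_integrable[OF L2_space_component[OF L2(4)] T(1)] by simp_all
  have "(LINT x:\<Omega>|lebesgue. (v x + c * w x) * partial_deriv i \<phi> x) =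
      (LINT x:\<Omega>|lebesgue. v x * partial_deriv i \<phi> x + c * (w x * partial_deriv i \<phi> x))"
    by (simp add: algebra_simps)
  also have "\<dots> = (LINT x:\<Omega>|lebesgue. v x * partial_deriv i \<phi> x)
      + c * (LINT x:\<Omega>|lebesgue. w x * partial_deriv i \<phi> x)"
    using int by (subst set_integral_add) auto
  also have "\<dots> = - ((LINT x:\<Omega>|lebesgue. g x $ i * \<phi> x) + c * (LINT x:\<Omega>|lebesgue. h x $ i * \<phi> x))"
    using g h \<phi> unfolding is_weak_gradient_def by simp
  also have "(LINT x:\<Omega>|lebesgue. g x $ i * \<phi> x) + c * (LINT x:\<Omega>|lebesgue. h x $ i * \<phi> x) =
      (LINT x:\<Omega>|lebesgue. g x $ i * \<phi> x + c * (h x $ i * \<phi> x))"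
    using int by (subst set_integral_add) auto
  also have "\<dots> = (LINT x:\<Omega>|lebesgue. (g x + c *\<^sub>R h x) $ i * \<phi> x)"
    by (simp add: algebra_simps)
  finally show "(LINT x:\<Omega>|lebesgue. (v x + c * w x) * partial_deriv i \<phi> x) =
      - (LINT x:\<Omega>|lebesgue. (g x + c *\<^sub>R h x) $ i * \<phi> x)" .
qed

text \<open>Two weak gradients of one function have the same integrals against all test functions, so the
  fundamental lemma applies to each component of their difference.\<close>

lemma weak_gradient_unique:
  fixes v :: "real^'d \<Rightarrow> real"
  assumes \<Omega>: "open \<Omega>" "bounded \<Omega>"
    and L2: "g \<in> L2_space \<Omega>" "h \<in> L2_space \<Omega>"
    and g: "is_weak_gradient \<Omega> v g" and h: "is_weak_gradient \<Omega> v h"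
  shows "AE x in lebesgue. x \<in> \<Omega> \<longrightarrow> g x = h x"
proof -
  have "AE x in lebesgue. x \<in> \<Omega> \<longrightarrow> g x $ i - h x $ i = 0" for i
  proof (rule fundamental_lemma_calculus_of_variations[OF \<Omega>(1)])
    have one: "(\<lambda>x. 1::real) \<in> L2_space \<Omega>"
      by (intro continuous_in_L2_space \<Omega> continuous_intros)
    have "set_integrable lebesgue \<Omega> (\<lambda>x. g x $ i)" "set_integrable lebesgue \<Omega> (\<lambda>x. h x $ i)"
      using L2_inner_integrable[OF L2_space_component[OF L2(1)] one]
        L2_inner_integrable[OF L2_space_component[OF L2(2)] one] by simp_all
    then show "set_integrable lebesgue \<Omega> (\<lambda>x. g x $ i - h x $ i)"
      by (rule set_integral_diff)
    fix \<phi> assume \<phi>: "\<phi> \<in> test_functions \<Omega>"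
    note T = test_function_in_L2[OF \<Omega> \<phi>]
    have "set_integrable lebesgue \<Omega> (\<lambda>x. g x $ i * \<phi> x)"
      "set_integrable lebesgue \<Omega> (\<lambda>x. h x $ i * \<phi> x)"
      using L2_inner_integrable[OF L2_space_component[OF L2(1)] T(1)]
        L2_inner_integrable[OF L2_space_component[OF L2(2)] T(1)] by simp_all
    then have "(LINT x:\<Omega>|lebesgue. g x $ i * \<phi> x - h x $ i * \<phi> x) =
        (LINT x:\<Omega>|lebesgue. g x $ i * \<phi> x) - (LINT x:\<Omega>|lebesgue. h x $ i * \<phi> x)"
      by (rule set_integral_diff)
    also have "\<dots> = 0"
      using g h \<phi> unfolding is_weak_gradient_def by (metis (no_types, lifting) add.inverse_inverse diff_self)
    finally show "(LINT x:\<Omega>|lebesgue. (g x $ i - h x $ i) * \<phi> x) = 0"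
      by (simp add: algebra_simps)
  qed
  then have "AE x in lebesgue. \<forall>i\<in>UNIV. x \<in> \<Omega> \<longrightarrow> g x $ i - h x $ i = 0"
    by (intro AE_finite_allI) auto
  then show ?thesis
    by eventually_elim (simp add: vec_eq_iff)
qed

lemma weak_grad_works:
  assumes "v \<in> H1_space \<Omega>"
  shows "weak_grad \<Omega> v \<in> L2_space \<Omega>" "is_weak_gradient \<Omega> v (weak_grad \<Omega> v)"
proof -
  have "\<exists>g. g \<in> L2_space \<Omega> \<and> is_weak_gradient \<Omega> v g"
    using assms by (auto simp: H1_space_def)
  from someI_ex[OF this]
  show "weak_grad \<Omega> v \<in> L2_space \<Omega>" "is_weak_gradient \<Omega> v (weak_grad \<Omega> v)"
    by (auto simp: weak_grad_def)
qed

lemma H1_space_lin: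
  fixes v w :: "real^'d \<Rightarrow> real"
  assumes \<Omega>: "open \<Omega>" "bounded \<Omega>" and v: "v \<in> H1_space \<Omega>" and w: "w \<in> H1_space \<Omega>"
  shows "(\<lambda>x. v x + c * w x) \<in> H1_space \<Omega>"
proof -
  have L2: "v \<in> L2_space \<Omega>" "w \<in> L2_space \<Omega>" using v w by (auto simp: H1_space_def)
  have "is_weak_gradient \<Omega> (\<lambda>x. v x + c * w x) (\<lambda>x. weak_grad \<Omega> v x + c *\<^sub>R weak_grad \<Omega> w x)"
    by (intro weak_gradient_lin \<Omega> L2 weak_grad_works v w)
  moreover have "(\<lambda>x. weak_grad \<Omega> v x + c *\<^sub>R weak_grad \<Omega> w x) \<in> L2_space \<Omega>"
    by (intro L2_space_lin weak_grad_works v w)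
  moreover have "(\<lambda>x. v x + c * w x) \<in> L2_space \<Omega>"
    using L2_space_lin[OF L2, of c] by simp
  ultimately show ?thesis by (auto simp: H1_space_def)
qed

lemma zero_in_H1_space: "(\<lambda>x. 0) \<in> H1_space \<Omega>"
proof -
  have z: "(\<lambda>x. 0::'b::euclidean_space) \<in> L2_space \<Omega>"
    by (simp add: L2_space_def set_borel_measurable_def set_integrable_def)
  show ?thesis unfolding H1_space_def
    by (auto intro!: z bexI[OF _ z] simp: is_weak_gradient_def)
qed

lemma A_form_symmetric: "A_form \<Omega> (\<lambda>_. e) u v = A_form \<Omega> (\<lambda>_. e) v u"
  by (simp add: A_form_def inner_commute)

lemma A_form_nonneg: "e \<ge> 0 \<Longrightarrow> A_form \<Omega> (\<lambda>_. e) v v \<ge> 0"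
  unfolding A_form_def set_lebesgue_integral_def by (intro Bochner_Integration.integral_nonneg) simp

text \<open>The gradient chosen by \<open>weak_grad\<close> for \<open>v + c w\<close> need not be the combination of those chosen for
  \<open>v\<close> and \<open>w\<close>, but both are weak gradients of \<open>v + c w\<close> and hence agree almost everywhere.\<close>

lemma A_form_lin:
  fixes u v w :: "real^'d \<Rightarrow> real"
  assumes \<Omega>: "open \<Omega>" "bounded \<Omega>"
    and H1: "u \<in> H1_space \<Omega>" "v \<in> H1_space \<Omega>" "w \<in> H1_space \<Omega>"
  shows "A_form \<Omega> (\<lambda>_. e) u (\<lambda>x. v x + c * w x) = A_form \<Omega> (\<lambda>_. e) u v + c * A_form \<Omega> (\<lambda>_. e) u w"
proof -
  let ?G = "weak_grad \<Omega>"
  let ?vw = "\<lambda>x. v x + c * w x"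
  note L2 = weak_grad_works(1)[OF H1(1)] weak_grad_works(1)[OF H1(2)] weak_grad_works(1)[OF H1(3)]
  have vw: "?vw \<in> H1_space \<Omega>" by (rule H1_space_lin[OF \<Omega> H1(2,3)])
  have int: "set_integrable lebesgue \<Omega> (\<lambda>x. ?G u x \<bullet> ?G v x)"
    "set_integrable lebesgue \<Omega> (\<lambda>x. ?G u x \<bullet> ?G w x)"
    "set_integrable lebesgue \<Omega> (\<lambda>x. ?G u x \<bullet> ?G ?vw x)"
    by (intro L2_inner_integrable L2 weak_grad_works(1)[OF vw])+
  have "AE x in lebesgue. x \<in> \<Omega> \<longrightarrow> ?G ?vw x = ?G v x + c *\<^sub>R ?G w x"
  proof (rule weak_gradient_unique[OF \<Omega>])
    show "is_weak_gradient \<Omega> ?vw (\<lambda>x. ?G v x + c *\<^sub>R ?G w x)"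
      using H1 by (intro weak_gradient_lin[OF \<Omega>] weak_grad_works) (auto simp: H1_space_def)
  qed (intro L2_space_lin weak_grad_works H1 vw)+
  then have "AE x in lebesgue. x \<in> \<Omega> \<longrightarrow>
      ?G u x \<bullet> ?G ?vw x = ?G u x \<bullet> ?G v x + c * (?G u x \<bullet> ?G w x)"
    by eventually_elim (simp add: inner_add_right)
  then have "(LINT x:\<Omega>|lebesgue. ?G u x \<bullet> ?G ?vw x) =
      (LINT x:\<Omega>|lebesgue. ?G u x \<bullet> ?G v x + c * (?G u x \<bullet> ?G w x))"
    using int by (intro set_AE_cong_integral set_integral_add set_integrable_mult_right)
  also have "\<dots> = (LINT x:\<Omega>|lebesgue. ?G u x \<bullet> ?G v x) + c * (LINT x:\<Omega>|lebesgue. ?G u x \<bullet> ?G w x)"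
    using int by (subst set_integral_add) auto
  finally show ?thesis unfolding A_form_def by (simp add: algebra_simps)
qed

section \<open>The finite element space and the projection\<close>

lemma L2_inner_cong:
  assumes "open \<Omega>" "\<And>x. x \<in> \<Omega> \<Longrightarrow> f x = f' x" "\<And>x. x \<in> \<Omega> \<Longrightarrow> g x = g' x"
  shows "L2_inner \<Omega> f g = L2_inner \<Omega> f' g'"
  unfolding L2_inner_def using assms by (intro set_lebesgue_integral_cong) auto

lemma L2_inner_commute: "L2_inner \<Omega> f g = L2_inner \<Omega> g f"
  by (simp add: L2_inner_def mult.commute)

lemma L2_inner_scale: "L2_inner \<Omega> (\<lambda>x. c * f x) g = c * L2_inner \<Omega> f g"
  by (simp add: L2_inner_def mult.assoc)

lemma L2_inner_self_nonneg: "0 \<le> L2_inner \<Omega> f f"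
  unfolding L2_inner_def set_lebesgue_integral_def by (intro Bochner_Integration.integral_nonneg) simp

lemma L2_inner_lin:
  fixes f g h :: "real^'d \<Rightarrow> real"
  assumes \<Omega>: "open \<Omega>" "bounded \<Omega>"
    and fgh: "continuous_on (closure \<Omega>) f" "continuous_on (closure \<Omega>) g" "continuous_on (closure \<Omega>) h"
  shows "L2_inner \<Omega> f (\<lambda>x. g x + c * h x) = L2_inner \<Omega> f g + c * L2_inner \<Omega> f h"
    and "L2_inner \<Omega> (\<lambda>x. g x + c * h x) f = L2_inner \<Omega> g f + c * L2_inner \<Omega> h f"
proof -
  have int: "set_integrable lebesgue \<Omega> (\<lambda>x. f x * g x)" "set_integrable lebesgue \<Omega> (\<lambda>x. f x * h x)"
    by (rule set_integrable_continuous_closure(2)[OF \<Omega>], intro continuous_intros fgh)+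
  have "L2_inner \<Omega> f (\<lambda>x. g x + c * h x) =
      (LINT x:\<Omega>|lebesgue. f x * g x + c * (f x * h x))"
    by (simp add: L2_inner_def algebra_simps)
  also have "\<dots> = L2_inner \<Omega> f g + c * L2_inner \<Omega> f h"
    unfolding L2_inner_def using int by (subst set_integral_add) auto
  finally show 1: "L2_inner \<Omega> f (\<lambda>x. g x + c * h x) = L2_inner \<Omega> f g + c * L2_inner \<Omega> f h" .
  then show "L2_inner \<Omega> (\<lambda>x. g x + c * h x) f = L2_inner \<Omega> g f + c * L2_inner \<Omega> h f"
    by (simp add: L2_inner_commute[of \<Omega> f])
qed

text \<open>Functions that agree on \<open>\<Omega>\<close> have the same set of weak gradients, hence the very same chosen one.\<close>

lemma A_form_cong:
  assumes "open \<Omega>" "\<And>x. x \<in> \<Omega> \<Longrightarrow> v x = w x"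
  shows "A_form \<Omega> a u v = A_form \<Omega> a u w"
proof -
  have "is_weak_gradient \<Omega> v = is_weak_gradient \<Omega> w"
    unfolding is_weak_gradient_def
    by (intro ext ball_cong refl all_cong1 arg_cong2[where f = "(=)"] set_lebesgue_integral_cong)
       (use assms in auto)
  then show ?thesis by (simp add: A_form_def weak_grad_def)
qed

lemma finite_multi_indices: "finite {\<alpha>::'d::finite \<Rightarrow> nat. (\<Sum>i\<in>UNIV. \<alpha> i) \<le> k}"
proof (rule finite_subset)
  show "{\<alpha>::'d \<Rightarrow> nat. (\<Sum>i\<in>UNIV. \<alpha> i) \<le> k} \<subseteq> PiE UNIV (\<lambda>_. {..k})"
  proof
    fix \<alpha> :: "'d \<Rightarrow> nat" assume "\<alpha> \<in> {\<alpha>. (\<Sum>i\<in>UNIV. \<alpha> i) \<le> k}"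
    then have "\<alpha> i \<le> k" for i
      using member_le_sum[of i UNIV \<alpha>] by simp
    then show "\<alpha> \<in> PiE UNIV (\<lambda>_. {..k})" by auto
  qed
  show "finite (PiE (UNIV :: 'd set) (\<lambda>_. {..k}))" by (intro finite_PiE) auto
qed

lemma poly_space_lin_closed: "lin_closed (poly_space k :: (real^'d \<Rightarrow> real) set)"
  unfolding lin_closed_def
proof (intro conjI ballI allI)
  show "(\<lambda>x. 0) \<in> (poly_space k :: (real^'d \<Rightarrow> real) set)"
    by (auto simp: poly_space_def intro!: exI[of _ "\<lambda>_. 0"])
next
  fix p q :: "real^'d \<Rightarrow> real" and c
  assume "p \<in> poly_space k" "q \<in> poly_space k"
  then obtain a b where
    "\<And>x. p x = (\<Sum>\<alpha>\<in>{\<alpha>. (\<Sum>i\<in>UNIV. \<alpha> i) \<le> k}. a \<alpha> * (\<Prod>i\<in>UNIV. (x $ i) ^ \<alpha> i))"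
    "\<And>x. q x = (\<Sum>\<alpha>\<in>{\<alpha>. (\<Sum>i\<in>UNIV. \<alpha> i) \<le> k}. b \<alpha> * (\<Prod>i\<in>UNIV. (x $ i) ^ \<alpha> i))"
    by (auto simp: poly_space_def)
  then show "(\<lambda>x. p x + c * q x) \<in> poly_space k"
    by (auto simp: poly_space_def sum_distrib_left sum.distrib algebra_simps
        intro!: exI[of _ "\<lambda>\<alpha>. a \<alpha> + c * b \<alpha>"])
qed

lemma V_h_lin_closed:
  assumes \<Omega>: "open \<Omega>" "bounded \<Omega>"
  shows "lin_closed (V_h \<Omega> \<T> k)"
  unfolding lin_closed_def
proof (intro conjI ballI allI)
  show "(\<lambda>x. 0) \<in> V_h \<Omega> \<T> k"
    using zero_in_H1_space lin_closedD(1)[OF poly_space_lin_closed]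
    by (fastforce simp: V_h_def C0_def)
next
  fix u v c assume u: "u \<in> V_h \<Omega> \<T> k" and v: "v \<in> V_h \<Omega> \<T> k"
  have "(\<lambda>x. u x + c * v x) \<in> C0 \<Omega>"
    using u v by (auto simp: V_h_def C0_def intro!: continuous_intros)
  moreover have "(\<lambda>x. u x + c * v x) \<in> H1_space \<Omega>"
    using u v by (intro H1_space_lin[OF \<Omega>]) (auto simp: V_h_def)
  moreover have "\<exists>p\<in>poly_space k. \<forall>x\<in>T. u x + c * v x = p x" if "T \<in> \<T>" for T
  proof -
    obtain p where p: "p \<in> poly_space k" "\<forall>x\<in>T. u x = p x"
      using u \<open>T \<in> \<T>\<close> by (auto simp: V_h_def)
    obtain q where q: "q \<in> poly_space k" "\<forall>x\<in>T. v x = q x"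
      using v \<open>T \<in> \<T>\<close> by (auto simp: V_h_def)
    show ?thesis
      using p q lin_closedD(2)[OF poly_space_lin_closed p(1) q(1), of c]
      by (intro bexI[of _ "\<lambda>x. p x + c * q x"]) auto
  qed
  ultimately show "(\<lambda>x. u x + c * v x) \<in> V_h \<Omega> \<T> k" by (auto simp: V_h_def)
qed

text \<open>Assigning to each point one cell that contains it, the restriction of any member of \<open>V_h\<close> to
  the closure of \<open>\<Omega>\<close> becomes a combination of the finitely many monomials cut off to the point
  sets of the single cells. The cut-off monomials are discontinuous and lie outside \<open>V_h\<close>; only
  the finiteness of this generating family matters.\<close>

lemma V_h_unisolvent:
  fixes \<Omega> :: "(real^'d) set"
  assumes fin: "finite \<T>" and cover: "\<Union>\<T> = closure \<Omega>"
  shows "\<exists>P. finite P \<and> (\<forall>v\<in>V_h \<Omega> \<T> k. (\<forall>x\<in>P. v x = 0) \<longrightarrow> (\<forall>x\<in>closure \<Omega>. v x = 0))"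
proof -
  define M where "M = {\<alpha>::'d \<Rightarrow> nat. (\<Sum>i\<in>UNIV. \<alpha> i) \<le> k}"
  define cell where "cell x = (SOME T. T \<in> \<T> \<and> x \<in> T)" for x
  have cell: "cell x \<in> \<T>" "x \<in> cell x" if "x \<in> closure \<Omega>" for x
  proof -
    have "\<exists>T. T \<in> \<T> \<and> x \<in> T" using that cover by blast
    from someI_ex[OF this] show "cell x \<in> \<T>" "x \<in> cell x" by (auto simp: cell_def)
  qed
  define G where "G = (\<lambda>(T, \<alpha>) x. if T = cell x then \<Prod>i\<in>UNIV. (x $ i) ^ \<alpha> i else 0)"
  have M: "finite M" unfolding M_def by (rule finite_multi_indices)
  then have "finite (\<T> \<times> M)" using fin by blast
  from unisolvent_points[OF this, of "closure \<Omega>" G] obtain P where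
    P: "finite P" "P \<subseteq> closure \<Omega>" and
    uni: "\<And>c. (\<forall>x\<in>P. (\<Sum>j\<in>\<T> \<times> M. c j * G j x) = 0) \<Longrightarrow>
      (\<forall>x\<in>closure \<Omega>. (\<Sum>j\<in>\<T> \<times> M. c j * G j x) = 0)" by blast
  have "\<forall>x\<in>closure \<Omega>. v x = 0" if v: "v \<in> V_h \<Omega> \<T> k" and v0: "\<forall>x\<in>P. v x = 0" for v
  proof -
    have "\<forall>T\<in>\<T>. \<exists>c. \<forall>x\<in>T. v x = (\<Sum>\<alpha>\<in>M. c \<alpha> * (\<Prod>i\<in>UNIV. (x $ i) ^ \<alpha> i))"
      using v by (fastforce simp: V_h_def poly_space_def M_def)
    then obtain c where
      c: "\<And>T x. T \<in> \<T> \<Longrightarrow> x \<in> T \<Longrightarrow> v x = (\<Sum>\<alpha>\<in>M. c T \<alpha> * (\<Prod>i\<in>UNIV. (x $ i) ^ \<alpha> i))"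
      by metis
    have v_eq: "v x = (\<Sum>j\<in>\<T> \<times> M. (case j of (T, \<alpha>) \<Rightarrow> c T \<alpha>) * G j x)" if x: "x \<in> closure \<Omega>" for x
    proof -
      have "(\<Sum>j\<in>\<T> \<times> M. (case j of (T, \<alpha>) \<Rightarrow> c T \<alpha>) * G j x) =
          (\<Sum>T\<in>\<T>. \<Sum>\<alpha>\<in>M. c T \<alpha> * G (T, \<alpha>) x)"
        by (simp add: sum.cartesian_product case_prod_unfold)
      also have "\<dots> = (\<Sum>T\<in>\<T>. if T = cell x then v x else 0)"
        by (intro sum.cong refl) (use cell[OF x] c in \<open>auto simp: G_def\<close>)
      also have "\<dots> = v x" using cell[OF x] fin by simp
      finally show ?thesis by simp
    qed
    then show ?thesis using uni[of "\<lambda>(T, \<alpha>). c T \<alpha>"] v0 P(2) by (auto simp: subset_iff)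
  qed
  then show ?thesis using P(1) by blast
qed

text \<open>Functions in \<open>V_h\<close> may differ outside the closure of \<open>\<Omega>\<close>, so \<open>a\<close> is never definite on \<open>V_h\<close> itself.
  It is enough that \<open>a\<close> and \<open>l\<close> depend only on values on the closure and that \<open>a\<close> is definite there.\<close>

lemma V_h_riesz:
  assumes \<Omega>: "open \<Omega>" "bounded \<Omega>" and mesh: "triangulates \<T> \<Omega>"
    and a: "\<And>u. u \<in> V_h \<Omega> \<T> k \<Longrightarrow> lin_fun (V_h \<Omega> \<T> k) (a u)" "\<And>u v. a u v = a v u"
    and a_cong: "\<And>u v w. \<forall>x\<in>closure \<Omega>. v x = w x \<Longrightarrow> a u v = a u w"
    and definite: "\<And>v x. v \<in> V_h \<Omega> \<T> k \<Longrightarrow> a v v = 0 \<Longrightarrow> x \<in> closure \<Omega> \<Longrightarrow> v x = 0"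
    and l: "lin_fun (V_h \<Omega> \<T> k) l"
    and l_cong: "\<And>v w. \<forall>x\<in>closure \<Omega>. v x = w x \<Longrightarrow> l v = l w"
  shows "\<exists>u\<in>V_h \<Omega> \<T> k. \<forall>v\<in>V_h \<Omega> \<T> k. a u v = l v"
proof -
  let ?V = "V_h \<Omega> \<T> k"
  have V: "lin_closed ?V" by (rule V_h_lin_closed[OF \<Omega>])
  have "finite \<T>" "\<Union>\<T> = closure \<Omega>"
    using mesh by (auto simp: triangulates_def triangulation_def)
  from V_h_unisolvent[OF this, of k] obtain P where P: "finite P"
    "\<And>v x. v \<in> ?V \<Longrightarrow> \<forall>x\<in>P. v x = 0 \<Longrightarrow> x \<in> closure \<Omega> \<Longrightarrow> v x = 0" by blast
  have a0: "a u v = 0" if "u \<in> ?V" "\<forall>x\<in>closure \<Omega>. v x = 0" for u v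
    using a_cong[of v "\<lambda>x. 0" u] lin_fun_zero[OF V a(1)[OF that(1)]] that(2) by simp
  show ?thesis
  proof (rule riesz_finite_points[OF P(1) V a(1) a(2) l])
    show "l v = 0" if "v \<in> ?V" "a v v = 0" for v
      using definite[OF that] l_cong[of v "\<lambda>x. 0"] lin_fun_zero[OF V l] by simp
    show "a u v = 0" if "u \<in> ?V" "v \<in> ?V" "a v v = 0" for u v
      using a0[OF that(1)] definite[OF that(2,3)] by blast
    show "a v v = 0" if "v \<in> ?V" "\<forall>x\<in>P. v x = 0" for v
      using a0[OF that(1)] P(2)[OF that] by blast
  qed
qed

lemma V_hD:
  assumes "v \<in> V_h \<Omega> \<T> k"
  shows "continuous_on (closure \<Omega>) v" "v \<in> H1_space \<Omega>"
  using assms by (auto simp: V_h_def C0_def)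

lemma L2_proj_works:
  fixes \<Omega> :: "(real^'d) set"
  assumes \<Omega>: "open \<Omega>" "bounded \<Omega>" and mesh: "triangulates \<T> \<Omega>" and f: "f \<in> C0 \<Omega>"
  shows "L2_proj \<Omega> (V_h \<Omega> \<T> k) f \<in> V_h \<Omega> \<T> k"
    and "\<phi> \<in> V_h \<Omega> \<T> k \<Longrightarrow> L2_inner \<Omega> (L2_proj \<Omega> (V_h \<Omega> \<T> k) f) \<phi> = L2_inner \<Omega> f \<phi>"
proof -
  let ?V = "V_h \<Omega> \<T> k"
  have fc: "continuous_on (closure \<Omega>) f" using f by (simp add: C0_def)
  have diff: "L2_inner \<Omega> (\<lambda>x. f x - w x) \<phi> = L2_inner \<Omega> f \<phi> - L2_inner \<Omega> w \<phi>"
    if "w \<in> ?V" "\<phi> \<in> ?V" for w \<phi>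
    using L2_inner_lin(2)[OF \<Omega> V_hD(1)[OF that(2)] fc V_hD(1)[OF that(1)], of "-1"] by simp
  have "\<exists>w\<in>?V. \<forall>\<phi>\<in>?V. L2_inner \<Omega> w \<phi> = L2_inner \<Omega> f \<phi>"
  proof (rule V_h_riesz[OF \<Omega> mesh])
    show "lin_fun ?V (L2_inner \<Omega> u)" if "u \<in> ?V" for u
      unfolding lin_fun_def using that by (intro ballI allI L2_inner_lin \<Omega> V_hD(1))
    show "lin_fun ?V (L2_inner \<Omega> f)"
      unfolding lin_fun_def by (intro ballI allI L2_inner_lin \<Omega> V_hD(1) fc)
    show "L2_inner \<Omega> u v = L2_inner \<Omega> v u" for u v by (rule L2_inner_commute)
    show "L2_inner \<Omega> u v = L2_inner \<Omega> u w" if "\<forall>x\<in>closure \<Omega>. v x = w x" for u v w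
      using that closure_subset by (intro L2_inner_cong \<Omega>) auto
    then show "L2_inner \<Omega> f v = L2_inner \<Omega> f w" if "\<forall>x\<in>closure \<Omega>. v x = w x" for v w
      using that by blast
    show "v x = 0" if "v \<in> ?V" "L2_inner \<Omega> v v = 0" "x \<in> closure \<Omega>" for v x
      using L2_inner_self_eq_0D[OF \<Omega> V_hD(1)] that by blast
  qed
  then have "\<exists>w. w \<in> ?V \<and> (\<forall>\<phi>\<in>?V. L2_inner \<Omega> (\<lambda>x. f x - w x) \<phi> = 0)"
    using diff by auto
  from someI_ex[OF this] have
    *: "L2_proj \<Omega> ?V f \<in> ?V \<and> (\<forall>\<phi>\<in>?V. L2_inner \<Omega> (\<lambda>x. f x - L2_proj \<Omega> ?V f x) \<phi> = 0)"
    unfolding L2_proj_def .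
  then show "L2_proj \<Omega> ?V f \<in> ?V" by blast
  show "L2_inner \<Omega> (L2_proj \<Omega> ?V f) \<phi> = L2_inner \<Omega> f \<phi>" if "\<phi> \<in> ?V"
    using * diff[of "L2_proj \<Omega> ?V f" \<phi>] that by auto
qed

section \<open>The time step\<close>

lemma continuous_on_H_fun:
  assumes F: "C1_on_interval I F F'" and u: "continuous_on S u"
    and adm: "\<And>x. x \<in> S \<Longrightarrow> u x \<in> I" "\<And>x. x \<in> S \<Longrightarrow> F (u x) + B > 0"
  shows "continuous_on S (\<lambda>x. H_fun F F' B (u x))"
proof -
  have "continuous_on I F'" "continuous_on I F"
    using F by (auto simp: C1_on_interval_def intro: DERIV_continuous_on)
  then have "continuous_on S (\<lambda>x. F' (u x))" "continuous_on S (\<lambda>x. F (u x))"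
    using u adm(1) by (auto intro: continuous_on_compose2)
  then show ?thesis
    unfolding H_fun_def using adm(2) by (intro continuous_intros) (auto simp: less_imp_neq[symmetric])
qed

lemma A_form_lin_left:
  fixes u v w :: "real^'d \<Rightarrow> real"
  assumes \<Omega>: "open \<Omega>" "bounded \<Omega>"
    and H1: "u \<in> H1_space \<Omega>" "v \<in> H1_space \<Omega>" "w \<in> H1_space \<Omega>"
  shows "A_form \<Omega> (\<lambda>_. e) (\<lambda>x. v x + c * w x) u = A_form \<Omega> (\<lambda>_. e) v u + c * A_form \<Omega> (\<lambda>_. e) w u"
  using A_form_lin[OF assms, of e c] by (simp add: A_form_symmetric[of \<Omega> e u])

text \<open>Midpoint value minus old value. The summands are arranged so that closure under linear
  combinations applies directly.\<close>

definition increment :: "(real^'d \<Rightarrow> real) \<Rightarrow> (real^'d \<Rightarrow> real) \<Rightarrow> real^'d \<Rightarrow> real" where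
  "increment u1 u2 = (\<lambda>x. 1/2 * u2 x + (- 1/2) * u1 x)"

text \<open>The bilinear form of the linear problem for the increment that remains once the new auxiliary
  variable has been eliminated; \<open>\<eta>\<close> stands for \<open>H\<close> at the extrapolated state. Writing the weight
  \<open>\<eta>\<^sup>2\<close> as one factor \<open>\<eta>\<close> on each argument makes symmetry and nonnegativity evident.\<close>

definition step_form ::
  "(real^'d) set \<Rightarrow> real \<Rightarrow> real \<Rightarrow> (real^'d \<Rightarrow> real) \<Rightarrow> (real^'d \<Rightarrow> real) \<Rightarrow> (real^'d \<Rightarrow> real) \<Rightarrow> real" where
  "step_form \<Omega> \<epsilon> \<Delta>t \<eta> u v = 2 / \<Delta>t * L2_inner \<Omega> u v + A_form \<Omega> (\<lambda>_. \<epsilon>\<^sup>2) u v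
     + 1/2 * L2_inner \<Omega> (\<lambda>x. \<eta> x * u x) (\<lambda>x. \<eta> x * v x)"

definition step_load ::
  "(real^'d) set \<Rightarrow> real \<Rightarrow> (real^'d \<Rightarrow> real) \<Rightarrow> (real^'d \<Rightarrow> real) \<Rightarrow> (real^'d \<Rightarrow> real) \<Rightarrow> (real^'d \<Rightarrow> real) \<Rightarrow> real" where
  "step_load \<Omega> \<epsilon> \<eta> u1 Uh v = - A_form \<Omega> (\<lambda>_. \<epsilon>\<^sup>2) u1 v - L2_inner \<Omega> (\<lambda>x. \<eta> x * Uh x) v"

lemma step_form_lin_fun:
  fixes \<Omega> :: "(real^'d) set"
  assumes \<Omega>: "open \<Omega>" "bounded \<Omega>" and \<eta>: "continuous_on (closure \<Omega>) \<eta>"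
    and u: "u \<in> V_h \<Omega> \<T> k"
  shows "lin_fun (V_h \<Omega> \<T> k) (step_form \<Omega> \<epsilon> \<Delta>t \<eta> u)"
  unfolding lin_fun_def
proof (intro ballI allI)
  fix v w c assume v: "v \<in> V_h \<Omega> \<T> k" and w: "w \<in> V_h \<Omega> \<T> k"
  note cont = V_hD(1)[OF u] V_hD(1)[OF v] V_hD(1)[OF w]
  have "L2_inner \<Omega> (\<lambda>x. \<eta> x * u x) (\<lambda>x. \<eta> x * (v x + c * w x)) =
      L2_inner \<Omega> (\<lambda>x. \<eta> x * u x) (\<lambda>x. \<eta> x * v x + c * (\<eta> x * w x))"
    by (simp add: algebra_simps)
  also have "\<dots> = L2_inner \<Omega> (\<lambda>x. \<eta> x * u x) (\<lambda>x. \<eta> x * v x)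
      + c * L2_inner \<Omega> (\<lambda>x. \<eta> x * u x) (\<lambda>x. \<eta> x * w x)"
    by (rule L2_inner_lin(1)[OF \<Omega>]; intro continuous_intros \<eta> cont)
  finally show "step_form \<Omega> \<epsilon> \<Delta>t \<eta> u (\<lambda>x. v x + c * w x) =
      step_form \<Omega> \<epsilon> \<Delta>t \<eta> u v + c * step_form \<Omega> \<epsilon> \<Delta>t \<eta> u w"
    using L2_inner_lin(1)[OF \<Omega> cont, of c] A_form_lin[OF \<Omega> V_hD(2)[OF u] V_hD(2)[OF v] V_hD(2)[OF w], of "\<epsilon>\<^sup>2" c]
    by (simp add: step_form_def algebra_simps)
qed

lemma step_form_commute: "step_form \<Omega> \<epsilon> \<Delta>t \<eta> u v = step_form \<Omega> \<epsilon> \<Delta>t \<eta> v u"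
  unfolding step_form_def
  by (simp add: L2_inner_commute[of \<Omega> u] A_form_symmetric[of \<Omega> _ u] L2_inner_commute[of \<Omega> "\<lambda>x. \<eta> x * u x"])

lemma step_form_definite:
  assumes \<Omega>: "open \<Omega>" "bounded \<Omega>" and dt: "\<Delta>t > 0"
    and v: "v \<in> V_h \<Omega> \<T> k" "step_form \<Omega> \<epsilon> \<Delta>t \<eta> v v = 0" and x: "x \<in> closure \<Omega>"
  shows "v x = 0"
proof -
  have "2 / \<Delta>t * L2_inner \<Omega> v v \<ge> 0" using L2_inner_self_nonneg[of \<Omega> v] dt by simp
  moreover have "A_form \<Omega> (\<lambda>_. \<epsilon>\<^sup>2) v v \<ge> 0" by (rule A_form_nonneg) simp
  ultimately have "2 / \<Delta>t * L2_inner \<Omega> v v = 0"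
    using v(2) L2_inner_self_nonneg[of \<Omega> "\<lambda>x. \<eta> x * v x"] unfolding step_form_def by linarith
  then have "L2_inner \<Omega> v v = 0" using dt by simp
  from L2_inner_self_eq_0D[OF \<Omega> V_hD(1)[OF v(1)] this x] show ?thesis .
qed

lemma step_form_solvable:
  fixes \<Omega> :: "(real^'d) set"
  assumes \<Omega>: "open \<Omega>" "bounded \<Omega>" and mesh: "triangulates \<T> \<Omega>" and dt: "\<Delta>t > 0"
    and \<eta>: "continuous_on (closure \<Omega>) \<eta>" and u1: "u1 \<in> V_h \<Omega> \<T> k" and Uh: "continuous_on (closure \<Omega>) Uh"
  shows "\<exists>d\<in>V_h \<Omega> \<T> k. \<forall>v\<in>V_h \<Omega> \<T> k. step_form \<Omega> \<epsilon> \<Delta>t \<eta> d v = step_load \<Omega> \<epsilon> \<eta> u1 Uh v"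
proof (rule V_h_riesz[OF \<Omega> mesh])
  have sub: "x \<in> \<Omega> \<Longrightarrow> x \<in> closure \<Omega>" for x using closure_subset by blast
  show "step_form \<Omega> \<epsilon> \<Delta>t \<eta> u v = step_form \<Omega> \<epsilon> \<Delta>t \<eta> u w" if "\<forall>x\<in>closure \<Omega>. v x = w x" for u v w
    unfolding step_form_def using that sub
    by (intro arg_cong2[where f = "(+)"] arg_cong2[where f = "(*)"] refl L2_inner_cong A_form_cong \<Omega>) auto
  show "step_load \<Omega> \<epsilon> \<eta> u1 Uh v = step_load \<Omega> \<epsilon> \<eta> u1 Uh w" if "\<forall>x\<in>closure \<Omega>. v x = w x" for v w
    unfolding step_load_def using that sub
    by (intro arg_cong2[where f = "(-)"] arg_cong[where f = uminus] L2_inner_cong A_form_cong \<Omega>) auto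
  have Uc: "continuous_on (closure \<Omega>) (\<lambda>x. \<eta> x * Uh x)" by (intro continuous_intros \<eta> Uh)
  show "lin_fun (V_h \<Omega> \<T> k) (step_load \<Omega> \<epsilon> \<eta> u1 Uh)"
    unfolding lin_fun_def
  proof (intro ballI allI)
    fix v w c assume v: "v \<in> V_h \<Omega> \<T> k" and w: "w \<in> V_h \<Omega> \<T> k"
    show "step_load \<Omega> \<epsilon> \<eta> u1 Uh (\<lambda>x. v x + c * w x) =
        step_load \<Omega> \<epsilon> \<eta> u1 Uh v + c * step_load \<Omega> \<epsilon> \<eta> u1 Uh w"
      using L2_inner_lin(1)[OF \<Omega> Uc V_hD(1)[OF v] V_hD(1)[OF w], of c]
        A_form_lin[OF \<Omega> V_hD(2)[OF u1] V_hD(2)[OF v] V_hD(2)[OF w], of "\<epsilon>\<^sup>2" c]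
      by (simp add: step_load_def algebra_simps)
  qed
qed (use step_form_lin_fun[OF \<Omega> \<eta>] step_form_commute step_form_definite[OF \<Omega> dt] in blast)+

text \<open>The pointwise equation says \<open>U2 = Uh + \<eta> d\<close>, where \<open>d\<close> is the increment, so the mean of the
  auxiliary variables is \<open>Uh + \<eta> d / 2\<close>. Inserting this in the weak equation, with the midpoint
  \<open>u1 + d\<close> in the gradient term, leaves a linear equation for \<open>d\<close> alone.\<close>

lemma scheme_step_iff:
  fixes \<Omega> :: "(real^'d) set"
  assumes \<Omega>: "open \<Omega>" "bounded \<Omega>" and dt: "\<Delta>t > 0"
    and u1: "u1 \<in> V_h \<Omega> \<T> k"
    and \<eta>: "continuous_on (closure \<Omega>) \<eta>" "\<And>x. \<eta> x = H (extrapolate u0 u1 x)"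
    and Uh: "continuous_on (closure \<Omega>) Uh" "Uh = L2_proj \<Omega> (V_h \<Omega> \<T> k) U1"
  shows "scheme_step \<Omega> \<T> k \<epsilon> H \<Delta>t u0 u1 U1 u2 U2 \<longleftrightarrow>
    u2 \<in> V_h \<Omega> \<T> k \<and> U2 \<in> C0 \<Omega> \<and>
    (\<forall>x\<in>closure \<Omega>. U2 x = Uh x + \<eta> x * increment u1 u2 x) \<and>
    (\<forall>\<phi>\<in>V_h \<Omega> \<T> k. step_form \<Omega> \<epsilon> \<Delta>t \<eta> (increment u1 u2) \<phi> = step_load \<Omega> \<epsilon> \<eta> u1 Uh \<phi>)"
    (is "?S \<longleftrightarrow> ?R")
proof -
  let ?V = "V_h \<Omega> \<T> k"
  let ?d = "increment u1 u2"
  let ?um = "\<lambda>x. 1/2 * (u1 x + u2 x)" and ?Um = "\<lambda>x. 1/2 * (U2 x + Uh x)"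
  have um: "?um = (\<lambda>x. u1 x + 1 * ?d x)" and um_diff: "?um x - u1 x = ?d x" for x
    by (auto simp: increment_def)
  have pointwise: "(?Um x - Uh x) / (1/2 * \<Delta>t) = 1/2 * \<eta> x * ((?um x - u1 x) / (1/2 * \<Delta>t)) \<longleftrightarrow>
      U2 x = Uh x + \<eta> x * ?d x" for x
  proof -
    have "1/2 * \<Delta>t \<noteq> 0" using dt by simp
    then have "(?Um x - Uh x) / (1/2 * \<Delta>t) = 1/2 * \<eta> x * ?d x / (1/2 * \<Delta>t) \<longleftrightarrow>
        ?Um x - Uh x = 1/2 * \<eta> x * ?d x"
      by (subst divide_cancel_right) blast
    also have "\<dots> \<longleftrightarrow> U2 x = Uh x + \<eta> x * ?d x" by auto
    finally show ?thesis unfolding um_diff times_divide_eq_right .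
  qed
  have weak: "L2_inner \<Omega> (\<lambda>x. (?um x - u1 x) / (1/2 * \<Delta>t)) \<phi> =
        - A_form \<Omega> (\<lambda>_. \<epsilon>\<^sup>2) ?um \<phi> - L2_inner \<Omega> (\<lambda>x. \<eta> x * ?Um x) \<phi> \<longleftrightarrow>
      step_form \<Omega> \<epsilon> \<Delta>t \<eta> ?d \<phi> = step_load \<Omega> \<epsilon> \<eta> u1 Uh \<phi>"
    if u2: "u2 \<in> ?V" and U2: "\<forall>x\<in>closure \<Omega>. U2 x = Uh x + \<eta> x * ?d x" and \<phi>: "\<phi> \<in> ?V" for \<phi>
  proof -
    have d: "?d \<in> ?V"
      unfolding increment_def by (rule lin_closed_combo[OF V_h_lin_closed[OF \<Omega>] u2 u1])
    have "L2_inner \<Omega> (\<lambda>x. (?um x - u1 x) / (1/2 * \<Delta>t)) \<phi> = L2_inner \<Omega> (\<lambda>x. 2 / \<Delta>t * ?d x) \<phi>"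
      unfolding um_diff by (simp add: field_simps)
    then have 1: "L2_inner \<Omega> (\<lambda>x. (?um x - u1 x) / (1/2 * \<Delta>t)) \<phi> = 2 / \<Delta>t * L2_inner \<Omega> ?d \<phi>"
      by (simp only: L2_inner_scale)
    have 2: "A_form \<Omega> (\<lambda>_. \<epsilon>\<^sup>2) ?um \<phi> = A_form \<Omega> (\<lambda>_. \<epsilon>\<^sup>2) u1 \<phi> + A_form \<Omega> (\<lambda>_. \<epsilon>\<^sup>2) ?d \<phi>"
      unfolding um
      using A_form_lin_left[OF \<Omega> V_hD(2)[OF \<phi>] V_hD(2)[OF u1] V_hD(2)[OF d], of "\<epsilon>\<^sup>2" 1] by simp
    have U2': "U2 x = Uh x + \<eta> x * ?d x" if "x \<in> \<Omega>" for x
      using U2 that closure_subset by blast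
    have "L2_inner \<Omega> (\<lambda>x. \<eta> x * ?Um x) \<phi> =
        L2_inner \<Omega> (\<lambda>x. \<eta> x * Uh x + 1/2 * (\<eta> x * (\<eta> x * ?d x))) \<phi>"
      by (rule L2_inner_cong[OF \<Omega>(1)]) (simp_all add: U2' algebra_simps)
    also have "\<dots> = L2_inner \<Omega> (\<lambda>x. \<eta> x * Uh x) \<phi> + 1/2 * L2_inner \<Omega> (\<lambda>x. \<eta> x * (\<eta> x * ?d x)) \<phi>"
      by (rule L2_inner_lin(2)[OF \<Omega> V_hD(1)[OF \<phi>]]; intro continuous_intros \<eta>(1) Uh(1) V_hD(1)[OF d])
    also have "L2_inner \<Omega> (\<lambda>x. \<eta> x * (\<eta> x * ?d x)) \<phi> = L2_inner \<Omega> (\<lambda>x. \<eta> x * ?d x) (\<lambda>x. \<eta> x * \<phi> x)"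
      by (simp add: L2_inner_def mult_ac)
    finally show ?thesis
      unfolding 1 2 step_form_def step_load_def by auto
  qed
  show ?thesis
    unfolding scheme_step_def Let_def Uh(2)[symmetric] \<eta>(2)[symmetric] pointwise
    using weak by blast
qed

lemma step_solution_unique:
  fixes \<Omega> :: "(real^'d) set"
  assumes \<Omega>: "open \<Omega>" "bounded \<Omega>" and dt: "\<Delta>t > 0"
    and \<eta>: "continuous_on (closure \<Omega>) \<eta>"
    and u1: "u1 \<in> V_h \<Omega> \<T> k" and u: "u \<in> V_h \<Omega> \<T> k" and v: "v \<in> V_h \<Omega> \<T> k"
    and eq: "\<And>\<phi>. \<phi> \<in> V_h \<Omega> \<T> k \<Longrightarrow>
      step_form \<Omega> \<epsilon> \<Delta>t \<eta> (increment u1 u) \<phi> = step_form \<Omega> \<epsilon> \<Delta>t \<eta> (increment u1 v) \<phi>"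
    and x: "x \<in> closure \<Omega>"
  shows "u x = v x"
proof -
  let ?V = "V_h \<Omega> \<T> k" and ?a = "step_form \<Omega> \<epsilon> \<Delta>t \<eta>"
  note V = V_h_lin_closed[OF \<Omega>, of \<T> k]
  have d: "increment u1 u \<in> ?V" "increment u1 v \<in> ?V"
    unfolding increment_def by (intro lin_closed_combo[OF V] u v u1)+
  define e where "e = (\<lambda>x. increment u1 u x + (-1) * increment u1 v x)"
  have e: "e \<in> ?V" unfolding e_def by (rule lin_closedD(2)[OF V d])
  have "?a e e = ?a e (increment u1 u) + (-1) * ?a e (increment u1 v)"
    by (subst (2) e_def) (rule lin_funD[OF step_form_lin_fun[OF \<Omega> \<eta> e] d])
  also have "\<dots> = 0" using eq[OF e] by (simp add: step_form_commute[of \<Omega> \<epsilon> \<Delta>t \<eta> e])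
  finally have "e x = 0" using step_form_definite[OF \<Omega> dt e _ x] by blast
  then show ?thesis by (simp add: e_def increment_def)
qed

text \<open>The projection error is orthogonal to the projection, so this is Pythagoras.\<close>

lemma L2_norm_projection_le:
  fixes \<Omega> :: "(real^'d) set"
  assumes \<Omega>: "open \<Omega>" "bounded \<Omega>" and mesh: "triangulates \<T> \<Omega>" and f: "f \<in> C0 \<Omega>"
  shows "L2_inner \<Omega> (L2_proj \<Omega> (V_h \<Omega> \<T> k) f) (L2_proj \<Omega> (V_h \<Omega> \<T> k) f) \<le> L2_inner \<Omega> f f"
proof -
  let ?p = "L2_proj \<Omega> (V_h \<Omega> \<T> k) f"
  let ?r = "\<lambda>x. f x + (-1) * ?p x"
  note p = L2_proj_works[OF \<Omega> mesh f, where k = k]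
  have pc: "continuous_on (closure \<Omega>) ?p" by (rule V_hD(1)[OF p(1)])
  have fc: "continuous_on (closure \<Omega>) f" using f by (simp add: C0_def)
  have rc: "continuous_on (closure \<Omega>) ?r" by (intro continuous_intros fc pc)
  have "L2_inner \<Omega> ?r ?r = L2_inner \<Omega> ?r f + (-1) * L2_inner \<Omega> ?r ?p"
    by (rule L2_inner_lin(1)[OF \<Omega> rc fc pc])
  also have "\<dots> = L2_inner \<Omega> f f - L2_inner \<Omega> ?p f - L2_inner \<Omega> f ?p + L2_inner \<Omega> ?p ?p"
    unfolding L2_inner_lin(2)[OF \<Omega> fc fc pc] L2_inner_lin(2)[OF \<Omega> pc fc pc] by simp
  also have "\<dots> = L2_inner \<Omega> f f - L2_inner \<Omega> ?p ?p"
    using p(2)[OF p(1)] by (simp add: L2_inner_commute[of \<Omega> ?p f])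
  finally show ?thesis using L2_inner_self_nonneg[of \<Omega> ?r] by simp
qed

text \<open>The weak equation is tested with the increment \<open>d\<close>. Since \<open>u2 = u1 + 2 d\<close> and
  \<open>U2 = Uh + \<eta> d\<close>, expanding the two squares in the energy at the new level produces exactly the
  terms of that equation: twice the equation gives the difference of the energies, and the
  term \<open>(4 / \<Delta>t) (d, d)\<close> left over is the squared norm of \<open>u2 - u1\<close> divided by \<open>\<Delta>t\<close>.\<close>

lemma energy_identity:
  fixes \<Omega> :: "(real^'d) set"
  assumes \<Omega>: "open \<Omega>" "bounded \<Omega>" and dt: "\<Delta>t > 0"
    and u1: "u1 \<in> V_h \<Omega> \<T> k" and u2: "u2 \<in> V_h \<Omega> \<T> k"
    and \<eta>: "continuous_on (closure \<Omega>) \<eta>" and Uh: "continuous_on (closure \<Omega>) Uh"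
    and U2: "\<And>x. x \<in> closure \<Omega> \<Longrightarrow> U2 x = Uh x + \<eta> x * increment u1 u2 x"
    and weak: "\<And>\<phi>. \<phi> \<in> V_h \<Omega> \<T> k \<Longrightarrow>
      step_form \<Omega> \<epsilon> \<Delta>t \<eta> (increment u1 u2) \<phi> = step_load \<Omega> \<epsilon> \<eta> u1 Uh \<phi>"
  shows "energy \<Omega> \<epsilon> B u2 U2 = energy \<Omega> \<epsilon> B u1 Uh - 1 / \<Delta>t * (L2_norm \<Omega> (\<lambda>x. u2 x - u1 x))\<^sup>2"
proof -
  let ?V = "V_h \<Omega> \<T> k" and ?L = "L2_inner \<Omega>" and ?A = "A_form \<Omega> (\<lambda>_. \<epsilon>\<^sup>2)"
  define d where "d = increment u1 u2"
  have d: "d \<in> ?V"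
    unfolding d_def increment_def by (rule lin_closed_combo[OF V_h_lin_closed[OF \<Omega>] u2 u1])
  note c = V_hD(1)[OF u1] V_hD(1)[OF u2] V_hD(1)[OF d]
  note H1 = V_hD(2)[OF u1] V_hD(2)[OF u2] V_hD(2)[OF d]
  have u2_eq: "u2 = (\<lambda>x. u1 x + 2 * d x)" by (auto simp: d_def increment_def)
  define w where "w = (\<lambda>x. \<eta> x * d x)"
  have wc: "continuous_on (closure \<Omega>) w" unfolding w_def by (intro continuous_intros \<eta> c)
  have "?A u2 u2 = ?A u1 u2 + 2 * ?A d u2"
    by (subst (1) u2_eq) (rule A_form_lin_left[OF \<Omega> H1(2,1,3)])
  moreover have "?A u1 u2 = ?A u1 u1 + 2 * ?A u1 d"
    by (subst (1) u2_eq) (rule A_form_lin[OF \<Omega> H1(1,1,3)])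
  moreover have "?A d u2 = ?A d u1 + 2 * ?A d d"
    by (subst (1) u2_eq) (rule A_form_lin[OF \<Omega> H1(3,1,3)])
  ultimately have A: "?A u2 u2 = ?A u1 u1 + 4 * ?A u1 d + 4 * ?A d d"
    by (simp add: A_form_symmetric[of \<Omega> _ d u1])
  have "?L U2 U2 = ?L (\<lambda>x. Uh x + 1 * w x) (\<lambda>x. Uh x + 1 * w x)"
    using U2 closure_subset by (intro L2_inner_cong \<Omega>) (auto simp: w_def d_def subset_iff)
  also have "\<dots> = ?L Uh Uh + 2 * ?L Uh w + ?L w w"
  proof -
    have "continuous_on (closure \<Omega>) (\<lambda>x. Uh x + 1 * w x)" by (intro continuous_intros Uh wc)
    from L2_inner_lin(1)[OF \<Omega> this Uh wc, of 1] L2_inner_lin(2)[OF \<Omega> Uh Uh wc, of 1]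
      L2_inner_lin(2)[OF \<Omega> wc Uh wc, of 1]
    show ?thesis by (simp add: L2_inner_commute[of \<Omega> w Uh])
  qed
  finally have U: "?L U2 U2 = ?L Uh Uh + 2 * ?L Uh w + ?L w w" .
  have "(L2_norm \<Omega> (\<lambda>x. u2 x - u1 x))\<^sup>2 = ?L (\<lambda>x. 2 * d x) (\<lambda>x. 2 * d x)"
    using L2_inner_self_nonneg[of \<Omega>] by (simp add: L2_norm_def u2_eq)
  also have "\<dots> = ?L (\<lambda>x. 4 * d x) d"
    by (simp add: L2_inner_def algebra_simps)
  also have "\<dots> = 4 * ?L d d" by (rule L2_inner_scale)
  finally have N: "(L2_norm \<Omega> (\<lambda>x. u2 x - u1 x))\<^sup>2 = 4 * ?L d d" .
  have "?L (\<lambda>x. \<eta> x * Uh x) d = ?L Uh w"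
    by (simp add: L2_inner_def w_def mult_ac)
  then have "2 / \<Delta>t * ?L d d + ?A d d + 1/2 * ?L w w = - ?A u1 d - ?L Uh w"
    using weak[OF d] by (simp add: step_form_def step_load_def d_def[symmetric] w_def[symmetric])
  then show ?thesis
    using A U N unfolding energy_def L2_inner_def by (simp add: power2_eq_square algebra_simps)
qed

theorem theoremB2:
  fixes \<Omega> :: "(real^'d) set" and \<T> :: "(real^'d) set set"
    and \<sigma> \<epsilon> B \<Delta>t :: real and k :: nat and I :: "real set" and F F' :: "real \<Rightarrow> real"
    and u_prev u_n U_n :: "real^'d \<Rightarrow> real"
  assumes dim: "CARD('d) = 2 \<or> CARD('d) = 3"
    and domain: "open \<Omega>" "connected \<Omega>" "bounded \<Omega>" "\<Omega> \<noteq> {}"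
    and mesh: "triangulates \<T> \<Omega>" "quasi_uniform \<sigma> \<T>"
    and degree: "k \<ge> 1"
    and eps: "\<epsilon> > 0"
    and potential: "C1_on_interval I F F'"
    and B: "B \<ge> 0"
    and dt: "\<Delta>t > 0"
    and data: "u_prev \<in> V_h \<Omega> \<T> k" "u_n \<in> V_h \<Omega> \<T> k" "U_n \<in> C0 \<Omega>"
    and admissible: "\<And>x. x \<in> closure \<Omega> \<Longrightarrow> extrapolate u_prev u_n x \<in> I"
      "\<And>x. x \<in> closure \<Omega> \<Longrightarrow> F (extrapolate u_prev u_n x) + B > 0"
  shows
    "(\<exists>u U. scheme_step \<Omega> \<T> k \<epsilon> (H_fun F F' B) \<Delta>t u_prev u_n U_n u U) \<and>
     (\<forall>u U v V. scheme_step \<Omega> \<T> k \<epsilon> (H_fun F F' B) \<Delta>t u_prev u_n U_n u U \<and>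
                scheme_step \<Omega> \<T> k \<epsilon> (H_fun F F' B) \<Delta>t u_prev u_n U_n v V \<longrightarrow>
                (\<forall>x\<in>closure \<Omega>. u x = v x \<and> U x = V x)) \<and>
     (\<forall>u U. scheme_step \<Omega> \<T> k \<epsilon> (H_fun F F' B) \<Delta>t u_prev u_n U_n u U \<longrightarrow>
            energy \<Omega> \<epsilon> B u (L2_proj \<Omega> (V_h \<Omega> \<T> k) U) \<le> energy \<Omega> \<epsilon> B u U \<and>
            energy \<Omega> \<epsilon> B u U =
              energy \<Omega> \<epsilon> B u_n (L2_proj \<Omega> (V_h \<Omega> \<T> k) U_n)
              - 1 / \<Delta>t * (L2_norm \<Omega> (\<lambda>x. u x - u_n x))\<^sup>2)"
proof -
  let ?V = "V_h \<Omega> \<T> k"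
  let ?step = "scheme_step \<Omega> \<T> k \<epsilon> (H_fun F F' B) \<Delta>t u_prev u_n U_n"
  note \<Omega> = domain(1,3)
  define \<eta> where "\<eta> x = H_fun F F' B (extrapolate u_prev u_n x)" for x
  define Uh where "Uh = L2_proj \<Omega> ?V U_n"
  have "continuous_on (closure \<Omega>) (extrapolate u_prev u_n)"
    unfolding extrapolate_def using V_hD(1)[OF data(1)] V_hD(1)[OF data(2)] by (intro continuous_intros)
  then have \<eta>: "continuous_on (closure \<Omega>) \<eta>"
    unfolding \<eta>_def [abs_def] by (rule continuous_on_H_fun[OF potential]) (use admissible in auto)
  have Uh: "continuous_on (closure \<Omega>) Uh"
    unfolding Uh_def by (rule V_hD(1)[OF L2_proj_works(1)[OF \<Omega> mesh(1) data(3)]])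
  have iff: "?step u U \<longleftrightarrow> u \<in> ?V \<and> U \<in> C0 \<Omega> \<and>
      (\<forall>x\<in>closure \<Omega>. U x = Uh x + \<eta> x * increment u_n u x) \<and>
      (\<forall>\<phi>\<in>?V. step_form \<Omega> \<epsilon> \<Delta>t \<eta> (increment u_n u) \<phi> = step_load \<Omega> \<epsilon> \<eta> u_n Uh \<phi>)" for u U
    by (rule scheme_step_iff[OF \<Omega> dt data(2) \<eta> _ Uh]) (simp_all add: \<eta>_def Uh_def)
  have "\<exists>u U. ?step u U"
  proof -
    obtain d where d: "d \<in> ?V"
      "\<And>\<phi>. \<phi> \<in> ?V \<Longrightarrow> step_form \<Omega> \<epsilon> \<Delta>t \<eta> d \<phi> = step_load \<Omega> \<epsilon> \<eta> u_n Uh \<phi>"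
      using step_form_solvable[OF \<Omega> mesh(1) dt \<eta> data(2) Uh] by blast
    define u where "u = (\<lambda>x. u_n x + 2 * d x)"
    define U where "U = (\<lambda>x. Uh x + \<eta> x * d x)"
    have "increment u_n u = d" by (auto simp: increment_def u_def field_simps)
    moreover have "u \<in> ?V"
      unfolding u_def by (rule lin_closedD(2)[OF V_h_lin_closed[OF \<Omega>] data(2) d(1)])
    moreover have "U \<in> C0 \<Omega>"
      unfolding C0_def U_def using V_hD(1)[OF d(1)] by (auto intro!: continuous_intros \<eta> Uh)
    ultimately have "?step u U" unfolding iff using d(2) by (simp add: U_def)
    then show ?thesis by blast
  qed
  moreover have "u x = v x \<and> U x = V x" if "?step u U" "?step v V" "x \<in> closure \<Omega>" for u U v V x
  proof -
    have "u x = v x"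
      using that unfolding iff
      by (intro step_solution_unique[OF \<Omega> dt \<eta> data(2), of u v \<epsilon> x]) auto
    then show ?thesis using that unfolding iff by (simp add: increment_def)
  qed
  moreover have "energy \<Omega> \<epsilon> B u (L2_proj \<Omega> ?V U) \<le> energy \<Omega> \<epsilon> B u U" if "?step u U" for u U
    using that L2_norm_projection_le[OF \<Omega> mesh(1), where f = U and k = k]
    unfolding iff energy_def L2_inner_def by (simp add: power2_eq_square)
  moreover have "energy \<Omega> \<epsilon> B u U = energy \<Omega> \<epsilon> B u_n Uh - 1 / \<Delta>t * (L2_norm \<Omega> (\<lambda>x. u x - u_n x))\<^sup>2"
    if "?step u U" for u U
    using that unfolding iff by (intro energy_identity[OF \<Omega> dt data(2) _ \<eta> Uh]) auto
  ultimately show ?thesis unfolding Uh_def by blast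
qed

end
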